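(* We have $$T_{4,1}=\mathbb{N}\setminus\{1,2,4,7,30\},\quad \max(\mathbb{N}\setminus T_{6,1})=168,\quad \max(\mathbb{N}\setminus T_{6,5})=182.$$ Moreover, any integer $n\geq 2283$ can be written as $w(4w+1)+x(4x+1)+y(4y+1)+z(4z+1)$ with $w,x,y,z\in\mathbb{N}$, and each integer $n>4500$ can be written as $w(4w-1)+x(4x-1)+y(4y-1)+z(4z-1)$ with $w,x,y,z\in\mathbb{N}$.
   Context: $\mathbb{N}=\{0,1,2,\ldots\}$. For a positive integer $a$ and an integer $b$, $$T_{a,b}=\{w(aw+b)+x(ax+b)+y(ay+b)+z(az+b):\ w,x,y,z\in\mathbb{Z}\}.$$ *)

theory Defs
  imports Main
begin

definition T :: "int \<Rightarrow> int \<Rightarrow> int set" where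
  "T a b = {w * (a * w + b) + x * (a * x + b) + y * (a * y + b) + z * (a * z + b) | w x y z. True}"

end

theory Submission
  imports Defs
begin

text \<open>
  If \<open>A = w\<^sup>2 + x\<^sup>2 + y\<^sup>2 + z\<^sup>2\<close> and \<open>B = w + x + y + z\<close>, then \<open>a * A + b * B\<close> is the sum of
  the four terms \<open>w * (a * w + b)\<close>. By Cauchy's lemma such \<open>w, x, y, z\<close> exist as soon as
  \<open>4 * A - B\<^sup>2\<close> is a suitable sum of three squares, and they are nonnegative if moreover
  \<open>3 * A < B\<^sup>2 + 2 * B + 4\<close>. For large \<open>n = a * A + b * B\<close> the integer \<open>B\<close> can be chosen in a residue
  class for which the three squares theorem applies; the remaining \<open>n\<close> are checked by computation.

  The three squares theorem is obtained without Dirichlet's theorem. Let \<open>t\<^sub>m\<close> be the sum of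
  \<open>(-1) ^ (x + y + z)\<close> over the nonnegative solutions of \<open>x * y + y * z + z * x = m\<close>, where solutions
  with a zero entry count one half. Then the number of representations of \<open>m > 0\<close> by three squares is
  \<open>- 4 * (-1) ^ m * t\<^sub>m\<close>: both sides satisfy the recurrence
  \<open>(\<Sum>s. (n - 4 * s\<^sup>2) * F (n - s\<^sup>2)) = 0\<close>, which determines \<open>F\<close> from \<open>F 0\<close>. For three squares the
  recurrence is clear by symmetry in the four variables of \<open>n = s\<^sup>2 + a\<^sup>2 + b\<^sup>2 + c\<^sup>2\<close>. For \<open>t\<close> it follows
  from two involutions on the solutions of \<open>n = s\<^sup>2 + x * y + y * z + z * x\<close> that negate
  \<open>(s - x) * (s + y)\<close>, because the cyclic sum of these products is \<open>4 * s\<^sup>2 - n\<close>.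
\<close>

section \<open>A signed sum over the solutions of s*s + x*y + y*z + z*x = n\<close>

definition sgn_par :: "int \<Rightarrow> int" where
  "sgn_par t = (if even t then 1 else -1)"

lemma sgn_par_add: "sgn_par (a + b) = sgn_par a * sgn_par b"
  by (auto simp: sgn_par_def)

lemma sgn_par_cong: "even (a - b) \<Longrightarrow> sgn_par a = sgn_par b"
  by (auto simp: sgn_par_def)

lemma sgn_par_flip: "odd (a - b) \<Longrightarrow> sgn_par a = - sgn_par b"
  by (auto simp: sgn_par_def)

text \<open>Twice the weight of a coordinate, so that all weights are integers.\<close>
definition half_wt :: "int \<Rightarrow> int" where
  "half_wt t = (if t = 0 then 1 else 2)"

definition triples :: "int \<Rightarrow> (int \<times> int \<times> int) set" where
  "triples m = {(x, y, z). 0 \<le> x \<and> 0 \<le> y \<and> 0 \<le> z \<and> x * y + y * z + z * x = m}"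

definition wt :: "int \<times> int \<times> int \<Rightarrow> int" where
  "wt = (\<lambda>(x, y, z). half_wt x * half_wt y * half_wt z)"

definition tsum :: "int \<Rightarrow> int" where
  "tsum m = (\<Sum>(x, y, z)\<in>triples m. wt (x, y, z) * sgn_par (x + y + z))"

text \<open>The condition \<open>s^2 < n\<close> keeps the set finite: for \<open>s^2 = n\<close>
  the equation \<open>x * y + y * z + z * x = 0\<close> has infinitely many nonnegative solutions.
  Those \<open>s\<close> enter the recurrence through \<open>gsum 0\<close> instead.\<close>

definition quads :: "int \<Rightarrow> (int \<times> int \<times> int \<times> int) set" where
  "quads n = {(x, y, z, s). 0 \<le> x \<and> 0 \<le> y \<and> 0 \<le> z \<and> s^2 < n \<and> s^2 + x * y + y * z + z * x = n}"

lemma pos_combination_bound: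
  fixes x y z :: int
  assumes "0 \<le> x" "0 \<le> y" "0 \<le> z" "0 < x * y + y * z + z * x"
  shows "x \<le> x * y + y * z + z * x"
proof -
  have "y + z \<ge> 1" using assms by (cases "y + z = 0") (auto simp: add_nonneg_eq_0_iff)
  then have "x * 1 \<le> x * (y + z)" using assms by (intro mult_left_mono) auto
  moreover have "0 \<le> y * z" using assms by simp
  ultimately show ?thesis by (simp add: algebra_simps)
qed

lemma square_le_bound:
  fixes s n :: int
  assumes "s^2 \<le> n"
  shows "s \<in> {-n..n}"
proof -
  have "\<bar>s\<bar> \<le> \<bar>s\<bar> * \<bar>s\<bar>"
    using mult_left_mono[of 1 "\<bar>s\<bar>" "\<bar>s\<bar>"] by (cases "s = 0") auto
  then have "\<bar>s\<bar> \<le> s^2" by (simp add: power2_eq_square)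
  then show ?thesis using assms by auto
qed

lemma triples_subset: "m > 0 \<Longrightarrow> triples m \<subseteq> {0..m} \<times> {0..m} \<times> {0..m}"
  using pos_combination_bound
  by (auto simp: triples_def) (smt (verit) mult.commute)+

lemma finite_triples: "m > 0 \<Longrightarrow> finite (triples m)"
  by (rule finite_subset[OF triples_subset]) auto

lemma quads_eq_image:
  "quads n = (\<lambda>(s, x, y, z). (x, y, z, s)) ` (SIGMA s:{s. s^2 < n}. triples (n - s^2))"
  by (auto simp: quads_def triples_def image_iff)

lemma finite_squares_le: "finite {s::int. s^2 \<le> n}"
  by (rule finite_subset[of _ "{-n..n}"]) (use square_le_bound in auto)

lemma finite_squares_less: "finite {s::int. s^2 < n}"
  by (rule finite_subset[OF _ finite_squares_le[of n]]) auto

lemma finite_quads: "finite (quads n)"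
  unfolding quads_eq_image
  by (intro finite_imageI finite_SigmaI finite_squares_less) (auto intro: finite_triples)

fun qterm :: "int \<times> int \<times> int \<times> int \<Rightarrow> int" where
  "qterm (x, y, z, s) = wt (x, y, z) * sgn_par (s + x + y + z) * ((s - x) * (s + y))"

section \<open>Cancellation by reflection where \<open>ediff\<close> is at least
  \<open>height\<close>\<close>

text \<open>Reindexing by \<open>i\<close> shows that the sum equals its own negative. Fixed points
  do no harm, since \<open>f\<close> vanishes there.\<close>

lemma sum_neg_involution:
  fixes f :: "'a \<Rightarrow> int"
  assumes "\<And>v. v \<in> A \<Longrightarrow> i v \<in> A" "\<And>v. v \<in> A \<Longrightarrow> i (i v) = v"
    and "\<And>v. v \<in> A \<Longrightarrow> f (i v) = - f v"
  shows "sum f A = 0"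
proof -
  have "sum f A = (\<Sum>v\<in>A. - f v)"
    by (rule sum.reindex_bij_witness[where i = i and j = i]) (use assms in auto)
  then show ?thesis by (simp add: sum_negf)
qed

text \<open>The sum of the two factors \<open>s - x\<close> and \<open>s + y\<close> in
  \<open>qterm\<close>. Its sign and its size relative to \<open>z\<close> decide which involution
  applies.\<close>

definition ediff :: "int \<times> int \<times> int \<times> int \<Rightarrow> int" where
  "ediff = (\<lambda>(x, y, z, s). 2 * s + y - x)"

definition height :: "int \<times> int \<times> int \<times> int \<Rightarrow> int" where
  "height = (\<lambda>(x, y, z, s). z)"

text \<open>The reflection exchanges \<open>y\<close> with \<open>ediff - height\<close>. It negates
  \<open>s - x\<close> and keeps \<open>s + y\<close>, so their product changes sign.\<close>

definition qrefl :: "int \<times> int \<times> int \<times> int \<Rightarrow> int \<times> int \<times> int \<times> int" where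
  "qrefl = (\<lambda>(x, y, z, s). (z, 2 * s + y - x - z, x, z + x - s))"

lemma qrefl_qrefl: "qrefl (qrefl v) = v"
  by (auto simp: qrefl_def split: prod.split)

text \<open>The last hypothesis makes the new \<open>x * y + y * z + z * x\<close> positive, so that
  the new \<open>s\<close> again satisfies \<open>s^2 < n\<close>.\<close>

lemma qrefl_quads:
  assumes "(x, y, z, s) \<in> quads n" "2 * s + y - x - z \<ge> 0" "2 * s + y - x - z > 0 \<and> x + z > 0 \<or> x > 0 \<and> z > 0"
  shows "qrefl (x, y, z, s) \<in> quads n"
proof -
  let ?y = "2 * s + y - x - z"
  have eq: "(z + x - s)^2 + (z * ?y + ?y * x + x * z) = n"
    using assms(1) by (auto simp: quads_def power2_eq_square algebra_simps)
  have nn: "0 \<le> x" "0 \<le> z" using assms(1) by (auto simp: quads_def)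
  have "0 < z * ?y + ?y * x + x * z"
  proof (cases "?y > 0 \<and> x + z > 0")
    case True
    then have "0 < ?y * (x + z)" by simp
    then have "0 < ?y * (x + z) + x * z" using nn by (intro add_pos_nonneg) auto
    then show ?thesis by (simp add: algebra_simps)
  next
    case False
    then have "x > 0 \<and> z > 0" using assms(3) by blast
    then have "0 < x * z" by simp
    then show ?thesis using nn assms(2) by (intro add_nonneg_pos add_nonneg_nonneg mult_nonneg_nonneg)
  qed
  then show ?thesis using eq nn assms(2) by (auto simp: qrefl_def quads_def)
qed

lemma qrefl_sign_value:
  "sgn_par ((z + x - s) + z + (2 * s + y - x - z) + x) = sgn_par (s + x + y + z)"
  "((z + x - s) - z) * ((z + x - s) + (2 * s + y - x - z)) = - ((s - x) * (s + y))"
  by (rule sgn_par_cong, simp) (simp add: algebra_simps)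

lemma quads_posD:
  assumes "(x, y, z, s) \<in> quads n"
  shows "x + y > 0" "y + z > 0" "x + z > 0"
proof -
  have *: "x \<ge> 0" "y \<ge> 0" "z \<ge> 0" "x * y + y * z + z * x > 0" using assms by (auto simp: quads_def)
  show "x + y > 0" "y + z > 0" "x + z > 0"
    using * by (cases "x = 0"; cases "y = 0"; cases "z = 0"; simp)+
qed

text \<open>Here \<open>y\<close> and \<open>ediff - height\<close> are both positive. Exchanging
  them preserves the region and the weight, so \<open>qrefl\<close> only flips the sign.\<close>

lemma sum_above_pos: "(\<Sum>v\<in>{v \<in> quads n. ediff v > height v \<and> fst (snd v) > 0}. qterm v) = 0"
proof (rule sum_neg_involution[where i = qrefl])
  fix v assume v: "v \<in> {v \<in> quads n. ediff v > height v \<and> fst (snd v) > 0}"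
  obtain x y z s where vv: "v = (x, y, z, s)" by (cases v)
  have q: "(x, y, z, s) \<in> quads n" and c: "2 * s + y - x > z" "y > 0" using v by (auto simp: vv ediff_def height_def)
  note p = quads_posD[OF q]
  have "qrefl v \<in> quads n" unfolding vv by (rule qrefl_quads[OF q]) (use c p in auto)
  then show "qrefl v \<in> {v \<in> quads n. ediff v > height v \<and> fst (snd v) > 0}"
    using c by (auto simp: vv qrefl_def ediff_def height_def)
  show "qrefl (qrefl v) = v" by (rule qrefl_qrefl)
  show "qterm (qrefl v) = - qterm v"
    using c unfolding vv qrefl_def prod.case qterm.simps qrefl_sign_value
    by (simp add: wt_def half_wt_def)
qed

text \<open>On the boundary \<open>qrefl\<close> trades \<open>ediff = height\<close> for
  \<open>y = 0\<close>. The factor 2 appears because a zero \<open>y\<close> has half the weight of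
  a positive one.\<close>

lemma sum_above_zero:
  "(\<Sum>v\<in>{(x, y, z, s) \<in> quads n. 2 * s + y - x = z \<and> z > 0 \<and> x > 0 \<and> y > 0}. qterm v)
   = - 2 * (\<Sum>v\<in>{(x, y, z, s) \<in> quads n. 2 * s + y - x > z \<and> y = 0}. qterm v)"
  unfolding sum_distrib_left
proof (rule sum.reindex_bij_witness[where i = qrefl and j = qrefl])
  fix v assume v: "v \<in> {(x, y, z, s) \<in> quads n. 2 * s + y - x = z \<and> z > 0 \<and> x > 0 \<and> y > 0}"
  obtain x y z s where vv: "v = (x, y, z, s)" by (cases v)
  have q: "(x, y, z, s) \<in> quads n" and c: "2 * s + y - x = z" "z > 0" "x > 0" "y > 0" using v by (auto simp: vv)
  have "qrefl v \<in> quads n" unfolding vv by (rule qrefl_quads[OF q]) (use c in auto)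
  then show "qrefl v \<in> {(x, y, z, s) \<in> quads n. 2 * s + y - x > z \<and> y = 0}"
    using c by (auto simp: vv qrefl_def)
  show "qrefl (qrefl v) = v" by (rule qrefl_qrefl)
  show "- 2 * qterm (qrefl v) = qterm v"
    using c unfolding vv qrefl_def prod.case qterm.simps qrefl_sign_value
    by (simp add: wt_def half_wt_def)
next
  fix v assume v: "v \<in> {(x, y, z, s) \<in> quads n. 2 * s + y - x > z \<and> y = 0}"
  obtain x y z s where vv: "v = (x, y, z, s)" by (cases v)
  have q: "(x, y, z, s) \<in> quads n" and c: "2 * s + y - x > z" "y = 0" using v by (auto simp: vv)
  note p = quads_posD[OF q]
  have "qrefl v \<in> quads n" unfolding vv by (rule qrefl_quads[OF q]) (use c p in auto)
  then show "qrefl v \<in> {(x, y, z, s) \<in> quads n. 2 * s + y - x = z \<and> z > 0 \<and> x > 0 \<and> y > 0}"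
    using c p by (auto simp: vv qrefl_def)
  show "qrefl (qrefl v) = v" by (rule qrefl_qrefl)
qed

lemma sum_level_y0:
  "(\<Sum>v\<in>{(x, y, z, s) \<in> quads n. 2 * s + y - x = z \<and> z > 0 \<and> y = 0}. qterm v) = 0"
\<comment> \<open>Since \<open>2 * s = x + z\<close>, swapping \<open>x\<close> and \<open>z\<close>
  negates \<open>s - x\<close>, while \<open>s + y = s\<close> is unchanged.\<close>
proof (rule sum_neg_involution[where i = "\<lambda>(x, y, z, s). (z, y, x, s)"])
  fix v assume v: "v \<in> {(x, y, z, s) \<in> quads n. 2 * s + y - x = z \<and> z > 0 \<and> y = 0}"
  obtain x y z s where vv: "v = (x, y, z, s)" by (cases v)
  have q: "(x, y, z, s) \<in> quads n" and c: "2 * s - x = z" "y = 0" using v by (auto simp: vv)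
  note p = quads_posD[OF q]
  have "(z, y, x, s) \<in> quads n" using q by (simp add: quads_def algebra_simps)
  then show "(case v of (x, y, z, s) \<Rightarrow> (z, y, x, s)) \<in> {(x, y, z, s) \<in> quads n. 2 * s + y - x = z \<and> z > 0 \<and> y = 0}"
    using c p by (auto simp: vv)
  have z: "z = 2 * s - x" using c by simp
  show "qterm (case v of (x, y, z, s) \<Rightarrow> (z, y, x, s)) = - qterm v"
    by (simp add: vv wt_def z c(2) algebra_simps)
qed (auto split: prod.splits)

lemma sum_level_x0:
  "(\<Sum>v\<in>{(x, y, z, s) \<in> quads n. 2 * s + y - x = z \<and> z > 0 \<and> x = 0}. qterm v) = 0"
\<comment> \<open>With \<open>x = 0\<close> the first factor is \<open>s\<close>, which is negated.
  The second becomes \<open>z - s\<close>, which equals \<open>s + y\<close> on this level.\<close>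
proof (rule sum_neg_involution[where i = "\<lambda>(x, y, z, s). (x, z, y, - s)"])
  fix v assume v: "v \<in> {(x, y, z, s) \<in> quads n. 2 * s + y - x = z \<and> z > 0 \<and> x = 0}"
  obtain x y z s where vv: "v = (x, y, z, s)" by (cases v)
  have q: "(x, y, z, s) \<in> quads n" and c: "2 * s + y = z" "x = 0" using v by (auto simp: vv)
  note p = quads_posD[OF q]
  have "(x, z, y, - s) \<in> quads n" using q by (simp add: quads_def algebra_simps)
  then show "(case v of (x, y, z, s) \<Rightarrow> (x, z, y, - s)) \<in> {(x, y, z, s) \<in> quads n. 2 * s + y - x = z \<and> z > 0 \<and> x = 0}"
    using c p by (auto simp: vv)
  have z: "z = 2 * s + y" using c by simp
  have "sgn_par (- s + x + z + y) = sgn_par (s + x + y + z)" by (rule sgn_par_cong) simp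
  then show "qterm (case v of (x, y, z, s) \<Rightarrow> (x, z, y, - s)) = - qterm v"
    by (simp add: vv wt_def z c(2) algebra_simps)
qed (auto split: prod.splits)

text \<open>On the level \<open>ediff = height\<close> the points with \<open>x = 0\<close> or
  \<open>y = 0\<close> cancel among themselves. The others amount to \<open>-2\<close> times the
  part of the region with \<open>y = 0\<close>, which is all that the reflection leaves
  there.\<close>

lemma sum_above:
  "2 * (\<Sum>v\<in>{v \<in> quads n. ediff v > height v}. qterm v)
     + (\<Sum>v\<in>{v \<in> quads n. ediff v = height v \<and> height v > 0}. qterm v) = 0"
proof -
  let ?A = "{v \<in> quads n. ediff v > height v}"
  let ?A1 = "{v \<in> quads n. ediff v > height v \<and> fst (snd v) > 0}"
  let ?A2 = "{(x, y, z, s) \<in> quads n. 2 * s + y - x > z \<and> y = 0}"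
  let ?B = "{v \<in> quads n. ediff v = height v \<and> height v > 0}"
  let ?B1 = "{(x, y, z, s) \<in> quads n. 2 * s + y - x = z \<and> z > 0 \<and> x > 0 \<and> y > 0}"
  let ?B2 = "{(x, y, z, s) \<in> quads n. 2 * s + y - x = z \<and> z > 0 \<and> x = 0}"
  let ?B3 = "{(x, y, z, s) \<in> quads n. 2 * s + y - x = z \<and> z > 0 \<and> y = 0}"
  have fin: "finite X" if "X \<subseteq> quads n" for X using finite_subset[OF that finite_quads] .
  have A: "?A = ?A1 \<union> ?A2" by (auto simp: ediff_def height_def quads_def)
  have B: "?B = ?B1 \<union> (?B2 \<union> ?B3)" by (auto simp: ediff_def height_def quads_def)
  have dis: "?A1 \<inter> ?A2 = {}" "?B1 \<inter> (?B2 \<union> ?B3) = {}" "?B2 \<inter> ?B3 = {}"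
    using quads_posD by fastforce+
  have "sum qterm ?A = sum qterm ?A1 + sum qterm ?A2"
    unfolding A by (rule sum.union_disjoint) (use dis in \<open>auto intro!: fin\<close>)
  moreover have "sum qterm ?B = sum qterm ?B1 + (sum qterm ?B2 + sum qterm ?B3)"
    unfolding B by (subst sum.union_disjoint, (use dis in \<open>auto intro!: fin\<close>)[3], subst sum.union_disjoint)
      (use dis in \<open>auto intro!: fin\<close>)
  ultimately show ?thesis
    using sum_above_pos[of n] sum_above_zero[of n] sum_level_x0[of n] sum_level_y0[of n] by simp
qed

section \<open>Cancellation by division with remainder where \<open>0 < ediff\<close> and
  \<open>ediff\<close> is at most \<open>height\<close>\<close>

text \<open>The remainder \<open>a\<close> may equal \<open>e\<close>, so that either of
  \<open>a\<close> and \<open>b\<close> can be zero: in \<open>sum_below\<close> the pair becomes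
  the new \<open>(x, y)\<close>, where both cases occur.\<close>

definition fib :: "int \<Rightarrow> int \<Rightarrow> (int \<times> int \<times> int) set" where
  "fib e z = {(a, b, m). 0 \<le> a \<and> 0 \<le> b \<and> 1 \<le> m \<and> a + b = e \<and> a + m * e = z}"

lemma fib_eq:
  assumes "0 < e" "e \<le> z"
  shows "fib e z = (if z mod e > 0 then {(z mod e, e - z mod e, z div e)}
     else if z = e then {(0, e, 1)} else {(0, e, z div e), (e, 0, z div e - 1)})" (is "_ = ?F")
proof (rule set_eqI, clarify)
  fix a b m
  have zd: "z div e * e + z mod e = z" by simp
  have r: "0 \<le> z mod e" "z mod e < e" using assms by auto
  have k: "1 \<le> z div e" using assms by (simp add: pos_imp_zdiv_pos_iff int_one_le_iff_zero_less)
  show "(a, b, m) \<in> fib e z \<longleftrightarrow> (a, b, m) \<in> ?F"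
  proof
    assume "(a, b, m) \<in> fib e z"
    then have h: "0 \<le> a" "a \<le> e" "1 \<le> m" "b = e - a" "z = a + m * e" by (auto simp: fib_def)
    show "(a, b, m) \<in> ?F"
    proof (cases "a = e")
      case True
      then have "z = (m + 1) * e" using h by (simp add: algebra_simps)
      then have "z mod e = 0" "z div e = m + 1" "z \<noteq> e" using h assms by auto
      then show ?thesis using True h by simp
    next
      case False
      then have "z mod e = a" "z div e = m" using h assms by auto
      moreover have "m = 1" if "z = e" using that assms \<open>z div e = m\<close> by simp
      ultimately show ?thesis using h by auto
    qed
  next
    assume F: "(a, b, m) \<in> ?F"
    consider "z mod e > 0" | "z mod e = 0" "z = e" | "z mod e = 0" "z \<noteq> e" using r by linarith
    then show "(a, b, m) \<in> fib e z"
    proof cases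
      case 1
      then show ?thesis using F r k by (simp add: fib_def)
    next
      case 2
      then show ?thesis using F assms by (simp add: fib_def)
    next
      case 3
      then have "z = z div e * e" using zd by simp
      moreover have "z div e \<noteq> 1" using 3 calculation by auto
      moreover have "e + (z div e - 1) * e = z div e * e" by (simp add: algebra_simps)
      ultimately show ?thesis using 3 F assms k by (auto simp: fib_def)
    qed
  qed
qed

text \<open>A multiple of \<open>e\<close> has two divisions of weight 2 in place of one of weight
  4. For \<open>z = e\<close> the one with \<open>a = e\<close> is lost, because it would need
  \<open>m = 0\<close>.\<close>

lemma sum_fib:
  assumes "0 < e" "e \<le> z"
  shows "(\<Sum>(a, b, m)\<in>fib e z. half_wt a * half_wt b) = (if z = e then 2 else 4)"
proof -
  have "z mod e < e" "z mod e \<noteq> e" "z mod e \<ge> 0" using assms by (auto simp: less_imp_neq)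
  then show ?thesis using assms unfolding fib_eq[OF assms] by (auto simp: half_wt_def)
qed

lemma finite_fib: "0 < e \<Longrightarrow> e \<le> z \<Longrightarrow> finite (fib e z)"
  by (simp add: fib_eq)

text \<open>A division with remainder \<open>z = a + m * e\<close> exchanges the roles of \<open>x + y\<close> and \<open>e\<close>.\<close>
lemma sum_below:
  "2 * (\<Sum>v\<in>{v \<in> quads n. 0 < ediff v \<and> ediff v < height v}. qterm v)
     + (\<Sum>v\<in>{v \<in> quads n. ediff v = height v \<and> height v > 0}. qterm v) = 0"
proof -
  let ?B = "{v \<in> quads n. 0 < ediff v \<and> ediff v \<le> height v}"
  let ?B1 = "{v \<in> quads n. 0 < ediff v \<and> ediff v < height v}"
  let ?B2 = "{v \<in> quads n. ediff v = height v \<and> height v > 0}"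
  let ?S = "SIGMA v:?B. fib (ediff v) (height v)"
  let ?g = "\<lambda>(v, a, b, m). qterm v * (half_wt a * half_wt b)"
  let ?i = "\<lambda>((x, y, z, s), a, b, m). ((a, b, x + m * (x + y), s + y - b), x, y, m)"
  have fin: "finite X" if "X \<subseteq> quads n" for X using finite_subset[OF that finite_quads] .
  have "sum ?g ?S = 0"
  proof (rule sum_neg_involution[where i = ?i])
    fix w assume w: "w \<in> ?S"
    obtain x y z s a b m where ww: "w = ((x, y, z, s), a, b, m)" by (cases w) auto
    have q: "(x, y, z, s) \<in> quads n" using w by (auto simp: ww)
    have c: "0 < 2 * s + y - x" "2 * s + y - x \<le> z" "0 \<le> a" "0 \<le> b" "1 \<le> m"
      "a + b = 2 * s + y - x" "z = a + m * (a + b)"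
      using w by (auto simp: ww fib_def ediff_def height_def)
    have b: "b = 2 * s + y - x - a" using c by simp
    define Z where "Z = x + m * (x + y)"
    define S where "S = s + y - b"
    have iw: "?i w = ((a, b, Z, S), x, y, m)" by (simp add: ww Z_def S_def)
    have nn: "x \<ge> 0" "y \<ge> 0" "x + y > 0" "z > 0" using q quads_posD[OF q] c by (auto simp: quads_def)
    have mp: "m * (x + y) \<ge> x + y" using mult_right_mono[of 1 m "x + y"] c nn by simp
    then have Z: "Z \<ge> x + y" using nn unfolding Z_def by linarith
    have eq: "S^2 + a * b + b * Z + Z * a = n"
    proof -
      have "n = s^2 + x * y + y * z + z * x" using q by (simp add: quads_def)
      also have "\<dots> = S^2 + a * b + b * Z + Z * a"
        unfolding c(7) b S_def Z_def by algebra
      finally show ?thesis by simp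
    qed
    have "0 < Z * (a + b)" using Z nn c by (intro mult_pos_pos) auto
    moreover have "0 \<le> a * b" using c by simp
    moreover have "n = S^2 + (a * b + Z * (a + b))" using eq by (simp add: algebra_simps)
    ultimately have "S^2 < n" by linarith
    then have q': "(a, b, Z, S) \<in> quads n"
      using eq c Z nn by (simp add: quads_def)
    \<comment> \<open>The old \<open>ediff\<close> was \<open>a + b\<close> and the new one is
      \<open>x + y\<close>, so \<open>Z = x + m * (x + y)\<close> is a division of the new height by
      the new \<open>ediff\<close>.\<close>
    have e': "2 * S + b - a = x + y" using b by (simp add: S_def)
    show "?i w \<in> ?S" unfolding iw using q' e' Z nn c(3,4,5)
      by (simp add: ediff_def height_def fib_def Z_def)
    show "?i (?i w) = w" unfolding iw ww using c(7) by (simp add: S_def)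
    have "sgn_par (S + a + b + Z) = sgn_par (s + x + y + z)"
    proof (rule sgn_par_cong)
      have "S + a + b + Z - (s + x + y + z) = m * (2 * (x - s))"
        unfolding c(7) b S_def Z_def by algebra
      then show "even (S + a + b + Z - (s + x + y + z))" by simp
    qed
    moreover have "(S - a) * (S + b) = - ((s - x) * (s + y))" unfolding b S_def by algebra
    moreover have "half_wt Z = half_wt z" using Z nn by (simp add: half_wt_def)
    ultimately show "?g (?i w) = - ?g w" unfolding iw unfolding ww by (simp add: wt_def)
  qed
  moreover have "sum ?g ?S = (\<Sum>v\<in>?B. \<Sum>(a, b, m)\<in>fib (ediff v) (height v). qterm v * (half_wt a * half_wt b))"
    by (subst sum.Sigma[symmetric]) (auto intro: fin finite_fib simp: case_prod_unfold)
  \<comment> \<open>Summing out the divisions counts each point 4 times below the level and 2 times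
    on it.\<close>
  moreover have "\<dots> = (\<Sum>v\<in>?B. qterm v * (if height v = ediff v then 2 else 4))"
  proof (rule sum.cong)
    fix v assume "v \<in> ?B"
    then have "(\<Sum>(a, b, m)\<in>fib (ediff v) (height v). half_wt a * half_wt b) = (if height v = ediff v then 2 else 4)"
      by (intro sum_fib) auto
    then show "(\<Sum>(a, b, m)\<in>fib (ediff v) (height v). qterm v * (half_wt a * half_wt b))
        = qterm v * (if height v = ediff v then 2 else 4)"
      by (simp add: case_prod_unfold sum_distrib_left[symmetric])
  qed simp
  moreover have "?B = ?B1 \<union> ?B2" by auto
  moreover have "(\<Sum>v\<in>?B1 \<union> ?B2. qterm v * (if height v = ediff v then 2 else 4))
     = (\<Sum>v\<in>?B1. qterm v * 4) + (\<Sum>v\<in>?B2. qterm v * 2)"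
    by (subst sum.union_disjoint) (auto intro!: fin arg_cong2[where f = "(+)"] sum.cong)
  ultimately have "(\<Sum>v\<in>?B1. qterm v * 4) + (\<Sum>v\<in>?B2. qterm v * 2) = 0" by simp
  then show ?thesis by (simp add: sum_distrib_right[symmetric])
qed

section \<open>Reduction to the level \<open>ediff = 0\<close> and its evaluation\<close>

text \<open>Swapping \<open>x\<close> and \<open>y\<close> and negating \<open>s\<close> sends
  \<open>s - x\<close> to \<open>-(s + y)\<close> and \<open>s + y\<close> to
  \<open>-(s - x)\<close>: the product stays and the sum changes sign.\<close>

lemma sum_ediff_neg:
  "(\<Sum>v\<in>{v \<in> quads n. ediff v < 0}. qterm v) = (\<Sum>v\<in>{v \<in> quads n. ediff v > 0}. qterm v)"
proof (rule sum.reindex_bij_witness[where i = "\<lambda>(x, y, z, s). (y, x, z, - s)" and j = "\<lambda>(x, y, z, s). (y, x, z, - s)"], goal_cases)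
  case (5 v)
  obtain x y z s where vv: "v = (x, y, z, s)" by (cases v)
  have "sgn_par (- s + y + x + z) = sgn_par (s + x + y + z)" by (rule sgn_par_cong) simp
  then show ?case by (simp add: vv wt_def algebra_simps)
qed (auto simp: quads_def ediff_def algebra_simps)

lemma sum_quads_eq_level0: "sum qterm (quads n) = (\<Sum>v\<in>{v \<in> quads n. ediff v = 0}. qterm v)"
proof -
  let ?P = "{v \<in> quads n. ediff v > 0}" and ?N = "{v \<in> quads n. ediff v < 0}" and ?Z = "{v \<in> quads n. ediff v = 0}"
  let ?P1 = "{v \<in> quads n. ediff v > height v}" and ?P2 = "{v \<in> quads n. ediff v = height v \<and> height v > 0}"
   and ?P3 = "{v \<in> quads n. 0 < ediff v \<and> ediff v < height v}"
  have fin: "finite X" if "X \<subseteq> quads n" for X using finite_subset[OF that finite_quads] .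
  have P: "?P = ?P1 \<union> (?P2 \<union> ?P3)" by (auto simp: quads_def ediff_def height_def)
  have "sum qterm ?P = sum qterm ?P1 + (sum qterm ?P2 + sum qterm ?P3)"
    unfolding P by (subst sum.union_disjoint, (auto intro!: fin)[3], subst sum.union_disjoint) (auto intro!: fin)
  \<comment> \<open>Both \<open>sum_above\<close> and \<open>sum_below\<close> contain the level
    \<open>ediff = height\<close> once, so together they give twice the sum over
    \<open>?P\<close>.\<close>
  then have "sum qterm ?P = 0" using sum_above[of n] sum_below[of n] by simp
  moreover have "quads n = ?P \<union> (?N \<union> ?Z)" by auto
  then have "sum qterm (quads n) = sum qterm (?P \<union> (?N \<union> ?Z))" by simp
  moreover have "\<dots> = sum qterm ?P + (sum qterm ?N + sum qterm ?Z)"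
    by (subst sum.union_disjoint, (auto intro!: fin)[3], subst sum.union_disjoint) (auto intro!: fin)
  ultimately show ?thesis using sum_ediff_neg[of n] by simp
qed

text \<open>On this level \<open>s + y = x - s\<close>. The weights of \<open>x\<close> and
  \<open>y\<close> combine to a sum of two indicators because \<open>x\<close> and \<open>y\<close>
  are not both zero.\<close>

lemma qterm_level0:
  assumes "(x, y, z, s) \<in> quads n" "2 * s = x - y"
  shows "qterm (x, y, z, s) = half_wt z * sgn_par (s + x + y + z) * - ((x - s)^2)
     * ((if x > 0 then 2 else 0) + (if y > 0 then 2 else 0))"
proof -
  have y: "y = x - 2 * s" using assms(2) by simp
  have "half_wt x * half_wt y = (if x > 0 then 2 else 0) + (if y > 0 then 2 else 0)"
    using assms(1) quads_posD(1)[OF assms(1)] by (auto simp: quads_def half_wt_def)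
  moreover have "(s - x) * (s + y) = - ((x - s)^2)" unfolding y power2_eq_square by (simp add: algebra_simps)
  ultimately show ?thesis by (simp add: wt_def mult_ac)
qed

text \<open>Raising \<open>x\<close> and \<open>s\<close> by one and lowering \<open>y\<close> by
  one keeps \<open>x + y\<close> and \<open>x - s\<close> but flips the parity sign. It matches the
  terms with \<open>y > 0\<close> to those with \<open>x > 0\<close>, so the two indicator sums
  cancel. Positivity of \<open>z\<close> preserves \<open>s^2 < n\<close>.\<close>

lemma sum_level0_pos: "(\<Sum>v\<in>{(x, y, z, s) \<in> quads n. 2 * s = x - y \<and> z > 0}. qterm v) = 0"
proof -
  let ?A = "{(x, y, z, s) \<in> quads n. 2 * s = x - y \<and> z > 0}"
  let ?c = "\<lambda>(x, y, z, s). half_wt z * sgn_par (s + x + y + z) * - ((x - s)^2) * 2"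
  have fin: "finite ?A" by (rule finite_subset[OF _ finite_quads]) auto
  have "sum qterm ?A = (\<Sum>(x, y, z, s)\<in>?A. (if x > 0 then ?c (x, y, z, s) else 0) + (if y > 0 then ?c (x, y, z, s) else 0))"
    by (rule sum.cong, simp) (auto simp: qterm_level0 simp del: qterm.simps)
  also have "\<dots> = (\<Sum>(x, y, z, s)\<in>?A. if x > 0 then ?c (x, y, z, s) else 0) + (\<Sum>(x, y, z, s)\<in>?A. if y > 0 then ?c (x, y, z, s) else 0)"
    by (simp add: case_prod_unfold sum.distrib)
  also have "(\<Sum>(x, y, z, s)\<in>?A. if x > 0 then ?c (x, y, z, s) else 0) = (\<Sum>v\<in>{(x, y, z, s) \<in> ?A. x > 0}. ?c v)"
    by (rule sum.mono_neutral_cong_right) (use fin in \<open>auto split: if_splits\<close>)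
  also have "(\<Sum>(x, y, z, s)\<in>?A. if y > 0 then ?c (x, y, z, s) else 0) = (\<Sum>v\<in>{(x, y, z, s) \<in> ?A. y > 0}. ?c v)"
    by (rule sum.mono_neutral_cong_right) (use fin in \<open>auto split: if_splits\<close>)
  also have "(\<Sum>v\<in>{(x, y, z, s) \<in> ?A. y > 0}. ?c v) = (\<Sum>v\<in>{(x, y, z, s) \<in> ?A. x > 0}. - ?c v)"
  proof (rule sum.reindex_bij_witness[where i = "\<lambda>(x, y, z, s). (x - 1, y + 1, z, s - 1)"
        and j = "\<lambda>(x, y, z, s). (x + 1, y - 1, z, s + 1)"])
    fix v assume v: "v \<in> {(x, y, z, s) \<in> ?A. y > 0}"
    obtain x y z s where vv: "v = (x, y, z, s)" by (cases v)
    have h: "0 \<le> x" "0 < y" "0 < z" "s^2 + x * y + y * z + z * x = n" "x = 2 * s + y" using v by (auto simp: vv quads_def)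
    have eq: "(s + 1)^2 + (x + 1) * (y - 1) + (y - 1) * z + z * (x + 1) = n"
      using h(4) unfolding h(5) by (simp add: power2_eq_square algebra_simps)
    have "0 < z * (x + 1)" using h by simp
    moreover have "0 \<le> (x + 1) * (y - 1)" "0 \<le> (y - 1) * z" using h by auto
    ultimately have "(s + 1)^2 < n" using eq by linarith
    then show "(case v of (x, y, z, s) \<Rightarrow> (x + 1, y - 1, z, s + 1)) \<in> {(x, y, z, s) \<in> ?A. x > 0}"
      using eq h by (simp add: vv quads_def)
    have "sgn_par (s + 1 + (x + 1) + (y - 1) + z) = - sgn_par (s + x + y + z)" by (rule sgn_par_flip) simp
    moreover have "x + 1 - (s + 1) = x - s" by simp
    ultimately show "- ?c (case v of (x, y, z, s) \<Rightarrow> (x + 1, y - 1, z, s + 1)) = ?c v"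
      unfolding vv prod.case by (simp only: mult_minus_left mult_minus_right minus_minus)
  next
    fix v assume v: "v \<in> {(x, y, z, s) \<in> ?A. x > 0}"
    obtain x y z s where vv: "v = (x, y, z, s)" by (cases v)
    have h: "0 < x" "0 \<le> y" "0 < z" "s^2 + x * y + y * z + z * x = n" "x = 2 * s + y" using v by (auto simp: vv quads_def)
    have eq: "(s - 1)^2 + (x - 1) * (y + 1) + (y + 1) * z + z * (x - 1) = n"
      using h(4) unfolding h(5) by (simp add: power2_eq_square algebra_simps)
    have "0 < (y + 1) * z" using h by simp
    moreover have "0 \<le> (x - 1) * (y + 1)" "0 \<le> z * (x - 1)" using h by auto
    ultimately have "(s - 1)^2 < n" using eq by linarith
    then show "(case v of (x, y, z, s) \<Rightarrow> (x - 1, y + 1, z, s - 1)) \<in> {(x, y, z, s) \<in> ?A. y > 0}"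
      using eq h by (simp add: vv quads_def)
  qed (auto split: prod.splits)
  finally show ?thesis by (simp add: sum_negf)
qed

lemma sum_alternating: "(\<Sum>s\<in>{- int k<..<int k}. sgn_par s) = (if k = 0 then 0 else - sgn_par (int k))"
proof (induction k)
  case (Suc k)
  show ?case
  proof (cases "k = 0")
    case True
    then have "{- int (Suc k)<..<int (Suc k)} = {0}" by auto
    then show ?thesis using True by (simp add: sgn_par_def)
  next
    case False
    have "{- int (Suc k)<..<int (Suc k)} = insert (- int k) (insert (int k) {- int k<..<int k})" by auto
    then show ?thesis using Suc False by (simp add: sgn_par_def)
  qed
qed simp

text \<open>With \<open>z = 0\<close> the equation reads \<open>n = ((x + y) / 2)^2\<close>. So
  \<open>n = k^2\<close>, \<open>x = k + s\<close> and \<open>y = k - s\<close> with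
  \<open>\<bar>s\<bar> < k\<close>, and an alternating sum over \<open>s\<close> remains.\<close>

lemma sum_level0_zero:
  "(\<Sum>v\<in>{(x, y, z, s) \<in> quads n. 2 * s = x - y \<and> z = 0}. qterm v)
     = (if \<exists>k>0. n = k^2 then 4 * sgn_par n * n else 0)"
proof (cases "\<exists>k>0. n = k^2")
  case False
  have "{(x, y, z, s) \<in> quads n. 2 * s = x - y \<and> z = 0} = {}"
  proof safe
    fix x y z s assume v: "(x, y, 0, s) \<in> quads n" "2 * s = x - y"
    have y: "y = x - 2 * s" using v by simp
    have "n = (x - s)^2" using v(1) unfolding y by (auto simp: quads_def power2_eq_square algebra_simps)
    moreover have "x - s > 0" using v quads_posD(1)[OF v(1)] by simp
    ultimately show "(x, y, 0, s) \<in> {}" using False by blast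
  qed
  then show ?thesis unfolding if_not_P[OF False] by (simp only: sum.empty)
next
  case True
  then obtain k :: int where k: "k > 0" "n = k^2" by blast
  let ?A = "{(x, y, z, s) \<in> quads n. 2 * s = x - y \<and> z = 0}"
  have A: "\<bar>s\<bar> < k \<and> x = k + s \<and> y = k - s" if v: "(x, y, z, s) \<in> ?A" for x y z s
  proof -
    have y: "y = x - 2 * s" and z: "z = 0" using v by auto
    have "k^2 = (x - s)^2" using v k(2) unfolding y by (auto simp: quads_def power2_eq_square algebra_simps)
    moreover have "x - s > 0"
    proof -
      have "(x, y, z, s) \<in> quads n" "2 * s = x - y" using v by blast+
      then show ?thesis using quads_posD(1) by fastforce
    qed
    ultimately have "k = x - s" using k power2_eq_iff_nonneg[of k "x - s"] by simp
    moreover have "\<bar>s\<bar> < k"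
    proof -
      have "(x, y, z, s) \<in> quads n" using v by blast
      then have "s^2 < n" by (simp add: quads_def)
      then have "\<bar>s\<bar>^2 < k^2" using k(2) by (simp only: power2_abs)
      then show ?thesis using k(1) power2_less_imp_less[of "\<bar>s\<bar>" k] by linarith
    qed
    ultimately show ?thesis using y by simp
  qed
  have "sum qterm ?A = (\<Sum>s\<in>{- k<..<k}. - 4 * n * sgn_par s)"
  proof (rule sum.reindex_bij_witness[where i = "\<lambda>s. (k + s, k - s, 0, s)" and j = "\<lambda>(x, y, z, s). s"])
    fix s assume s: "s \<in> {- k<..<k}"
    have "s^2 < k^2" using s k power_strict_mono[of "\<bar>s\<bar>" k 2] by auto
    moreover have "s^2 + (k + s) * (k - s) = k^2" by (simp add: power2_eq_square algebra_simps)
    ultimately show "(k + s, k - s, 0, s) \<in> ?A" using s k by (simp add: quads_def)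
  next
    fix v assume v: "v \<in> ?A"
    obtain x y z s where vv: "v = (x, y, z, s)" by (cases v)
    have h: "\<bar>s\<bar> < k" "x = k + s" "y = k - s" "z = 0" using A[of x y z s] v by (auto simp: vv)
    show "(case v of (x, y, z, s) \<Rightarrow> s) \<in> {- k<..<k}" using h by (auto simp: vv)
    show "(\<lambda>s. (k + s, k - s, 0, s)) (case v of (x, y, z, s) \<Rightarrow> s) = v" using h by (simp add: vv)
    have "sgn_par (s + (k + s) + (k - s) + 0) = sgn_par s" by (rule sgn_par_cong) simp
    moreover have "half_wt (k + s) = 2" "half_wt (k - s) = 2" using h by (auto simp: half_wt_def)
    ultimately show "- 4 * n * sgn_par (case v of (x, y, z, s) \<Rightarrow> s) = qterm v"
      using h k by (simp add: vv wt_def half_wt_def power2_eq_square)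
  qed simp
  also have "\<dots> = - 4 * n * (\<Sum>s\<in>{- int (nat k)<..<int (nat k)}. sgn_par s)"
    using k by (simp add: sum_distrib_left)
  also have "\<dots> = 4 * n * sgn_par k" unfolding sum_alternating using k by simp
  also have "sgn_par k = sgn_par n" using k by (simp add: sgn_par_def)
  finally show ?thesis using True by simp
qed

lemma sum_quads:
  "sum qterm (quads n) = (if \<exists>k>0. n = k^2 then 4 * sgn_par n * n else 0)"
proof -
  let ?P = "{(x, y, z, s) \<in> quads n. 2 * s = x - y \<and> z > 0}" and ?Z = "{(x, y, z, s) \<in> quads n. 2 * s = x - y \<and> z = 0}"
  have "{v \<in> quads n. ediff v = 0} = ?P \<union> ?Z" by (auto simp: ediff_def quads_def)
  moreover have "sum qterm (?P \<union> ?Z) = sum qterm ?P + sum qterm ?Z"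
    by (rule sum.union_disjoint) (auto intro: finite_subset[OF _ finite_quads])
  ultimately show ?thesis
    using sum_quads_eq_level0[of n] sum_level0_pos[of n] sum_level0_zero[of n] by simp
qed

section \<open>Sums of three squares\<close>

lemma sum_quads_rot:
  fixes f :: "int \<times> int \<times> int \<times> int \<Rightarrow> int"
  shows "(\<Sum>(x, y, z, s)\<in>quads n. f (y, z, x, s)) = sum f (quads n)"
  by (rule sum.reindex_bij_witness[where i = "\<lambda>(x, y, z, s). (z, x, y, s)" and j = "\<lambda>(x, y, z, s). (y, z, x, s)"])
    (auto simp: quads_def algebra_simps)

text \<open>Weight and sign are invariant under rotation of \<open>x, y, z\<close>, so the three
  cyclic products \<open>(s - x) * (s + y)\<close>, with sum \<open>4 * s^2 - n\<close>, contribute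
  equally.\<close>

lemma sum_quads_weighted:
  "(\<Sum>(x, y, z, s)\<in>quads n. wt (x, y, z) * sgn_par (s + x + y + z) * (n - 4 * s^2)) = - 3 * sum qterm (quads n)"
proof -
  have "(\<Sum>(x, y, z, s)\<in>quads n. wt (x, y, z) * sgn_par (s + x + y + z) * (n - 4 * s^2))
    = (\<Sum>(x, y, z, s)\<in>quads n. - (qterm (x, y, z, s) + (qterm (y, z, x, s) + qterm (z, x, y, s))))"
  proof (rule sum.cong, simp, safe)
    fix x y z s assume "(x, y, z, s) \<in> quads n"
    then have n: "n - 4 * s^2 = - ((s - x) * (s + y) + ((s - y) * (s + z) + (s - z) * (s + x)))"
      by (auto simp: quads_def power2_eq_square algebra_simps)
    have *: "s + y + z + x = s + x + y + z" "s + z + x + y = s + x + y + z" by simp_all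
    have w: "wt (y, z, x) = wt (x, y, z)" "wt (z, x, y) = wt (x, y, z)" by (simp_all add: wt_def)
    show "wt (x, y, z) * sgn_par (s + x + y + z) * (n - 4 * s^2)
      = - (qterm (x, y, z, s) + (qterm (y, z, x, s) + qterm (z, x, y, s)))"
      unfolding qterm.simps * w n by algebra
  qed
  also have "\<dots> = - (sum qterm (quads n) + ((\<Sum>(x, y, z, s)\<in>quads n. qterm (y, z, x, s)) + (\<Sum>(x, y, z, s)\<in>quads n. qterm (z, x, y, s))))"
    by (simp add: sum_negf sum.distrib sum_subtractf case_prod_unfold del: qterm.simps)
  also have "(\<Sum>(x, y, z, s)\<in>quads n. qterm (z, x, y, s)) = (\<Sum>(x, y, z, s)\<in>quads n. qterm (y, z, x, s))"
    using sum_quads_rot[of "\<lambda>(x, y, z, s). qterm (y, z, x, s)" n] by (simp del: qterm.simps)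
  also have "\<dots> = sum qterm (quads n)" by (rule sum_quads_rot)
  finally show ?thesis by simp
qed

definition rep3 :: "int \<Rightarrow> (int \<times> int \<times> int) set" where
  "rep3 m = {(a, b, c). a^2 + b^2 + c^2 = m}"

definition r3 :: "int \<Rightarrow> int" where "r3 m = int (card (rep3 m))"

text \<open>Twice the number of representations by three squares, as \<open>r3_eq_gsum\<close>
  shows. The value at 0 is set by hand because \<open>triples 0\<close> is infinite.\<close>

definition gsum :: "int \<Rightarrow> int" where "gsum m = (if m = 0 then 2 else - sgn_par m * tsum m)"

lemma gsum_recurrence:
  assumes "n > 0"
  shows "(\<Sum>s\<in>{s. s^2 \<le> n}. (n - 4 * s^2) * gsum (n - s^2)) = 0"
proof -
  let ?L = "{s. s^2 < n}" and ?E = "{s::int. s^2 = n}"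
  have "(\<Sum>s\<in>?L. (n - 4 * s^2) * gsum (n - s^2))
     = (\<Sum>s\<in>?L. \<Sum>(x, y, z)\<in>triples (n - s^2). - sgn_par n * (wt (x, y, z) * sgn_par (s + x + y + z) * (n - 4 * s^2)))"
  proof (rule sum.cong, simp)
    fix s assume "s \<in> ?L"
    moreover have "sgn_par (n - s^2) = sgn_par n * sgn_par s" by (auto simp: sgn_par_def)
    ultimately have "(n - 4 * s^2) * gsum (n - s^2)
      = (\<Sum>(x, y, z)\<in>triples (n - s^2). (n - 4 * s^2) * (- (sgn_par n * sgn_par s) * (wt (x, y, z) * sgn_par (x + y + z))))"
      by (simp add: gsum_def tsum_def sum_distrib_left case_prod_unfold)
    also have "\<dots> = (\<Sum>(x, y, z)\<in>triples (n - s^2). - sgn_par n * (wt (x, y, z) * sgn_par (s + x + y + z) * (n - 4 * s^2)))"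
    proof (rule sum.cong, simp, safe)
      fix x y z :: int
      have *: "sgn_par (s + x + y + z) = sgn_par s * sgn_par (x + y + z)"
        using sgn_par_add[of s "x + y + z"] by (simp add: add.assoc)
      show "(n - 4 * s^2) * (- (sgn_par n * sgn_par s) * (wt (x, y, z) * sgn_par (x + y + z)))
        = - sgn_par n * (wt (x, y, z) * sgn_par (s + x + y + z) * (n - 4 * s^2))" unfolding * by algebra
    qed
    finally show "(n - 4 * s^2) * gsum (n - s^2)
      = (\<Sum>(x, y, z)\<in>triples (n - s^2). - sgn_par n * (wt (x, y, z) * sgn_par (s + x + y + z) * (n - 4 * s^2)))" .
  qed
  also have "\<dots> = (\<Sum>(s, x, y, z)\<in>(SIGMA s:?L. triples (n - s^2)). - sgn_par n * (wt (x, y, z) * sgn_par (s + x + y + z) * (n - 4 * s^2)))"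
    by (subst sum.Sigma) (auto simp: finite_squares_less finite_triples case_prod_unfold)
  also have "\<dots> = (\<Sum>(x, y, z, s)\<in>quads n. - sgn_par n * (wt (x, y, z) * sgn_par (s + x + y + z) * (n - 4 * s^2)))"
    by (rule sum.reindex_bij_witness[where i = "\<lambda>(x, y, z, s). (s, x, y, z)" and j = "\<lambda>(s, x, y, z). (x, y, z, s)"])
      (auto simp: quads_def triples_def)
  also have "\<dots> = - sgn_par n * (- 3 * sum qterm (quads n))"
    by (simp only: sum_quads_weighted[symmetric]) (simp add: sum_distrib_left case_prod_unfold)
  also have "\<dots> = (if \<exists>k>0. n = k^2 then 12 * n else 0)"
  proof (cases "\<exists>k>0. n = k^2")
    case True
    show ?thesis unfolding sum_quads if_P[OF True] by (simp add: sgn_par_def)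
  next
    case False
    show ?thesis unfolding sum_quads if_not_P[OF False] by simp
  qed
  finally have L: "(\<Sum>s\<in>?L. (n - 4 * s^2) * gsum (n - s^2)) = (if \<exists>k>0. n = k^2 then 12 * n else 0)" .
  \<comment> \<open>For \<open>n = k^2\<close> the two terms \<open>s = k\<close> and
    \<open>s = -k\<close> are \<open>- 3 * n * gsum 0 = - 6 * n\<close> each, which cancels the
    \<open>12 * n\<close> left by the terms with \<open>s^2 < n\<close>.\<close>
  have E: "(\<Sum>s\<in>?E. (n - 4 * s^2) * gsum (n - s^2)) = (if \<exists>k>0. n = k^2 then - 12 * n else 0)"
  proof (cases "\<exists>k>0. n = k^2")
    case True
    then obtain k :: int where k: "k > 0" "n = k^2" by blast
    then have "?E = {k, -k}" by (auto simp: power2_eq_iff)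
    then show ?thesis using k True by (simp add: gsum_def)
  next
    case False
    have "?E = {}"
    proof safe
      fix s assume "n = s^2"
      then have "n = \<bar>s\<bar>^2 \<and> \<bar>s\<bar> > 0" using assms by auto
      then show "s \<in> {}" using False by blast
    qed
    then show ?thesis unfolding if_not_P[OF False] by (simp only: sum.empty)
  qed
  have aux: "(if P then 12 * n else 0) + (if P then - 12 * n else 0) = 0" for P by simp
  have "{s. s^2 \<le> n} = ?L \<union> ?E" by auto
  then have "(\<Sum>s\<in>{s. s^2 \<le> n}. (n - 4 * s^2) * gsum (n - s^2)) = (\<Sum>s\<in>?L \<union> ?E. (n - 4 * s^2) * gsum (n - s^2))" by simp
  also have "\<dots> = (\<Sum>s\<in>?L. (n - 4 * s^2) * gsum (n - s^2)) + (\<Sum>s\<in>?E. (n - 4 * s^2) * gsum (n - s^2))"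
    by (rule sum.union_disjoint) (auto intro: finite_subset[OF _ finite_squares_le[of n]])
  also have "\<dots> = 0" unfolding L E by (rule aux)
  finally show ?thesis .
qed

lemma finite_rep3: "finite (rep3 m)"
proof (rule finite_subset)
  have "a^2 \<le> m \<and> b^2 \<le> m \<and> c^2 \<le> m" if "a^2 + b^2 + c^2 = m" for a b c :: int
    using that zero_le_power2[of a] zero_le_power2[of b] zero_le_power2[of c] by linarith
  then show "rep3 m \<subseteq> {-m..m} \<times> {-m..m} \<times> {-m..m}"
    unfolding rep3_def using square_le_bound by blast
qed simp

lemma r3_recurrence: "(\<Sum>s\<in>{s. s^2 \<le> n}. (n - 4 * s^2) * r3 (n - s^2)) = 0"
proof -
  let ?Q = "{(s, a, b, c). s^2 + a^2 + b^2 + c^2 = n}"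
  have Q: "?Q = (SIGMA s:{s. s^2 \<le> n}. rep3 (n - s^2))"
  proof -
    have "s^2 \<le> s^2 + a^2 + b^2 + c^2" for s a b c :: int
      using zero_le_power2[of a] zero_le_power2[of b] zero_le_power2[of c] by linarith
    then show ?thesis by (auto simp: rep3_def)
  qed
  have "(\<Sum>s\<in>{s. s^2 \<le> n}. (n - 4 * s^2) * r3 (n - s^2)) = (\<Sum>s\<in>{s. s^2 \<le> n}. \<Sum>v\<in>rep3 (n - s^2). n - 4 * s^2)"
    by (simp add: r3_def mult.commute)
  also have "\<dots> = (\<Sum>(s, v)\<in>?Q. n - 4 * s^2)"
    unfolding Q by (subst sum.Sigma) (auto simp: finite_squares_le finite_rep3)
  \<comment> \<open>Each of the three differences is negated by exchanging \<open>s\<close> with the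
    other variable.\<close>
  also have "\<dots> = (\<Sum>(s, a, b, c)\<in>?Q. (a^2 - s^2) + ((b^2 - s^2) + (c^2 - s^2)))"
    by (rule sum.cong) auto
  also have "\<dots> = (\<Sum>(s, a, b, c)\<in>?Q. a^2 - s^2) + ((\<Sum>(s, a, b, c)\<in>?Q. b^2 - s^2) + (\<Sum>(s, a, b, c)\<in>?Q. c^2 - s^2))"
    unfolding case_prod_unfold sum.distrib ..
  also have "(\<Sum>(s, a, b, c)\<in>?Q. a^2 - s^2) = 0"
    by (rule sum_neg_involution[where i = "\<lambda>(s, a, b, c). (a, s, b, c)"]) auto
  also have "(\<Sum>(s, a, b, c)\<in>?Q. b^2 - s^2) = 0"
    by (rule sum_neg_involution[where i = "\<lambda>(s, a, b, c). (b, a, s, c)"]) auto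
  also have "(\<Sum>(s, a, b, c)\<in>?Q. c^2 - s^2) = 0"
    by (rule sum_neg_involution[where i = "\<lambda>(s, a, b, c). (c, a, b, s)"]) auto
  finally show ?thesis by simp
qed

text \<open>The term for \<open>s = 0\<close> is \<open>n * F n\<close>; all others involve
  \<open>F\<close> at smaller arguments.\<close>

lemma recurrence_unique:
  fixes F :: "int \<Rightarrow> int"
  assumes "F 0 = 0" and rec: "\<And>n. n > 0 \<Longrightarrow> (\<Sum>s\<in>{s. s^2 \<le> n}. (n - 4 * s^2) * F (n - s^2)) = 0"
  shows "F (int k) = 0"
proof (induction k rule: less_induct)
  case (less k)
  show ?case
  proof (cases "k = 0")
    case True
    then show ?thesis using assms(1) by simp
  next
    case False
    let ?n = "int k"
    have "(\<Sum>s\<in>{s. s^2 \<le> ?n} - {0}. (?n - 4 * s^2) * F (?n - s^2)) = 0"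
    proof (rule sum.neutral, rule ballI)
      fix s assume "s \<in> {s. s^2 \<le> ?n} - {0}"
      then have s: "s^2 \<le> ?n" "s \<noteq> 0" by simp_all
      have "nat (?n - s^2) < k"
        using zero_less_power2[of s] s by (subst nat_less_iff) linarith+
      then have "F (int (nat (?n - s^2))) = 0" by (rule less.IH)
      then show "(?n - 4 * s^2) * F (?n - s^2) = 0" using s by simp
    qed
    moreover have "(\<Sum>s\<in>{s. s^2 \<le> ?n}. (?n - 4 * s^2) * F (?n - s^2))
      = (?n - 4 * 0^2) * F (?n - 0^2) + (\<Sum>s\<in>{s. s^2 \<le> ?n} - {0}. (?n - 4 * s^2) * F (?n - s^2))"
      by (rule sum.remove) (auto simp: finite_squares_le)
    ultimately show ?thesis using rec[of ?n] False by simp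
  qed
qed

lemma r3_eq_gsum: assumes "n \<ge> 0" shows "2 * r3 n = gsum n"
proof -
  have "rep3 0 = {(0, 0, 0)}" by (auto simp: rep3_def sum_power2_eq_zero_iff add_nonneg_eq_0_iff)
  then have 0: "2 * r3 0 - gsum 0 = 0" by (simp add: r3_def gsum_def)
  have "2 * r3 (int (nat n)) - gsum (int (nat n)) = 0"
  proof (rule recurrence_unique[where F = "\<lambda>n. 2 * r3 n - gsum n"])
    fix n :: int assume n: "n > 0"
    have "(\<Sum>s\<in>{s. s^2 \<le> n}. (n - 4 * s^2) * (2 * r3 (n - s^2) - gsum (n - s^2)))
      = 2 * (\<Sum>s\<in>{s. s^2 \<le> n}. (n - 4 * s^2) * r3 (n - s^2)) - (\<Sum>s\<in>{s. s^2 \<le> n}. (n - 4 * s^2) * gsum (n - s^2))"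
      by (simp add: sum_distrib_left sum_subtractf[symmetric] algebra_simps)
    then show "(\<Sum>s\<in>{s. s^2 \<le> n}. (n - 4 * s^2) * (2 * r3 (n - s^2) - gsum (n - s^2))) = 0"
      using r3_recurrence[of n] gsum_recurrence[OF n] by simp
  qed (rule 0)
  then show ?thesis using assms by simp
qed

section \<open>Positivity of the count in suitable residue classes\<close>

lemma wt_ge: "wt (x, y, z) \<ge> 1"
  by (auto simp: wt_def half_wt_def)

lemma sum_three_squares_of_gsum_pos:
  assumes "n \<ge> 0" "gsum n > 0" shows "\<exists>a b c. n = a^2 + b^2 + c^2"
proof -
  have "r3 n > 0" using r3_eq_gsum[OF assms(1)] assms(2) by simp
  then have "rep3 n \<noteq> {}" by (auto simp: r3_def)
  then show ?thesis by (auto simp: rep3_def)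
qed

lemma one_mem_triples: "n > 0 \<Longrightarrow> (0, 1, n) \<in> triples n" by (simp add: triples_def)

text \<open>All terms of \<open>gsum n\<close> are positive. Three even entries would give
  \<open>n mod 4 = 0\<close> and three odd ones \<open>n mod 4 = 3\<close>; for all other parities
  \<open>n\<close> and \<open>x + y + z\<close> have opposite parity.\<close>

lemma three_squares_mod4:
  fixes n :: int
  assumes "n \<ge> 0" "n mod 4 = 1 \<or> n mod 4 = 2"
  shows "\<exists>a b c. n = a^2 + b^2 + c^2"
proof (rule sum_three_squares_of_gsum_pos)
  have n0: "n > 0" using assms by (cases "n = 0") auto
  have sg: "- sgn_par n * sgn_par (x + y + z) = 1" if "(x, y, z) \<in> triples n" for x y z
  proof -
    have n: "n = x * y + y * z + z * x" using that by (simp add: triples_def)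
    have "even n \<longleftrightarrow> odd (x + y + z)"
    proof (rule ccontr)
      assume "\<not> (even n \<longleftrightarrow> odd (x + y + z))"
      then consider "even x" "even y" "even z" | "odd x" "odd y" "odd z"
        unfolding n by auto
      then show False
      proof cases
        case 1
        then obtain a b c where "x = 2 * a" "y = 2 * b" "z = 2 * c" by (auto elim!: evenE)
        then have "n = 4 * (a * b + b * c + c * a)" unfolding n by simp
        then show False using assms by presburger
      next
        case 2
        then obtain a b c where "x = 2 * a + 1" "y = 2 * b + 1" "z = 2 * c + 1" by (auto elim!: oddE)
        then have "n = 4 * (a * b + b * c + c * a + a + b + c) + 3" unfolding n by (simp add: algebra_simps)
        then show False using assms by presburger
      qed
    qed
    then show ?thesis by (auto simp: sgn_par_def)
  qed
  have "gsum n = (\<Sum>(x, y, z)\<in>triples n. wt (x, y, z) * (- sgn_par n * sgn_par (x + y + z)))"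
    using n0 by (simp add: gsum_def tsum_def sum_distrib_left case_prod_unfold mult_ac)
  also have "\<dots> = (\<Sum>v\<in>triples n. wt v)" by (rule sum.cong) (use sg in auto)
  also have "\<dots> > 0"
    using wt_ge one_mem_triples[OF n0] by (intro sum_pos finite_triples[OF n0]) (auto simp: int_one_le_iff_zero_less)
  finally show "gsum n > 0" .
qed (rule assms)

text \<open>Triples of odd entries contribute \<open>-8\<close> each, and those with one even entry
  at least 4. With \<open>?E1\<close>, \<open>?E2\<close> and \<open>?E3\<close> of equal weight,
  \<open>gsum n\<close> is at least \<open>12 * card ?E1 - 8 * card ?O\<close>, so an injection of
  \<open>?O\<close> into \<open>?E1\<close> suffices.\<close>

lemma three_squares_mod8:
  fixes n :: int
  assumes "n \<ge> 0" "n mod 8 = 3"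
  shows "\<exists>a b c. n = a^2 + b^2 + c^2"
proof (rule sum_three_squares_of_gsum_pos)
  have n0: "n > 0" using assms by (cases "n = 0") auto
  have n_odd: "odd n" using assms by presburger
  let ?O = "{(x, y, z) \<in> triples n. odd x \<and> odd y \<and> odd z}"
  let ?E1 = "{(x, y, z) \<in> triples n. even x}" and ?E2 = "{(x, y, z) \<in> triples n. even y}"
    and ?E3 = "{(x, y, z) \<in> triples n. even z}"
  have fin: "finite X" if "X \<subseteq> triples n" for X using finite_subset[OF that finite_triples[OF n0]] .
  have par: "n = x * y + y * z + z * x" if "(x, y, z) \<in> triples n" for x y z
    using that by (simp add: triples_def)
  have one: "odd x \<or> odd y" "odd y \<or> odd z" "odd z \<or> odd x" if "(x, y, z) \<in> triples n" for x y z
    using n_odd unfolding par[OF that] by auto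
  have sgE: "sgn_par (x + y + z) = 1" if "(x, y, z) \<in> triples n" "even x \<or> even y \<or> even z" for x y z
    using that one[OF that(1)] by (auto simp: sgn_par_def)
  have un: "triples n = ?O \<union> (?E1 \<union> (?E2 \<union> ?E3))" by auto
  have dis: "?O \<inter> (?E1 \<union> (?E2 \<union> ?E3)) = {}" "?E1 \<inter> (?E2 \<union> ?E3) = {}" "?E2 \<inter> ?E3 = {}"
    using one by blast+
  let ?f = "\<lambda>(x, y, z). wt (x, y, z) * sgn_par (x + y + z)"
  have "gsum n = sum ?f (triples n)"
    using n0 n_odd by (simp add: gsum_def tsum_def sgn_par_def)
  also have "\<dots> = sum ?f (?O \<union> (?E1 \<union> (?E2 \<union> ?E3)))" by (subst un) (rule refl)
  also have "\<dots> = sum ?f ?O + (sum ?f ?E1 + (sum ?f ?E2 + sum ?f ?E3))"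
    by (subst sum.union_disjoint, (use dis in \<open>auto intro!: fin\<close>)[3])+ (rule refl)
  finally have g: "gsum n = sum ?f ?O + (sum ?f ?E1 + (sum ?f ?E2 + sum ?f ?E3))" .
  have O: "sum ?f ?O = - 8 * int (card ?O)"
  proof -
    have "sum ?f ?O = (\<Sum>v\<in>?O. - 8)"
      by (rule sum.cong) (auto simp: wt_def half_wt_def sgn_par_def)
    then show ?thesis by simp
  qed
  have E1: "sum ?f ?E1 \<ge> 4 * int (card ?E1)"
  proof -
    have "(\<Sum>v\<in>?E1. 4) \<le> sum ?f ?E1"
    proof (rule sum_mono, clarify)
      fix x y z assume v: "(x, y, z) \<in> triples n" "even x"
      then have "y \<noteq> 0" "z \<noteq> 0" using one[OF v(1)] by auto
      then show "4 \<le> wt (x, y, z) * sgn_par (x + y + z)"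
        using sgE[OF v(1)] v(2) by (simp add: wt_def half_wt_def)
    qed
    then show ?thesis by simp
  qed
  have rot: "sum ?f ?E2 = sum ?f ?E1" "sum ?f ?E3 = sum ?f ?E1"
    by (rule sum.reindex_bij_witness[where i = "\<lambda>(x, y, z). (z, x, y)" and j = "\<lambda>(x, y, z). (y, z, x)"];
        auto simp: triples_def wt_def algebra_simps)
      (rule sum.reindex_bij_witness[where i = "\<lambda>(x, y, z). (y, z, x)" and j = "\<lambda>(x, y, z). (z, x, y)"];
        auto simp: triples_def wt_def algebra_simps)
  \<comment> \<open>Half the difference of \<open>x\<close> and \<open>y\<close> becomes the even
    entry. The order of the last two entries reveals the branch, since \<open>z > 0\<close>, and
    then \<open>x, y, z\<close> can be recovered.\<close>
  let ?h = "\<lambda>(x::int, y::int, z::int). if x \<le> y then ((y - x) div 2, x, x + 2 * z) else ((x - y) div 2, y + 2 * z, y)"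
  \<comment> \<open>Modulo 8 the value 3 forces \<open>a, b, c\<close> to have equal parity, hence
    \<open>x\<close> and \<open>y\<close> agree modulo 4 and half their difference is even.\<close>
  have cong4: "\<exists>k. x - y = 4 * k" if v: "(x, y, z) \<in> ?O" for x y z
  proof -
    obtain a b c where abc: "x = 2 * a + 1" "y = 2 * b + 1" "z = 2 * c + 1"
      using v by (auto elim!: oddE)
    have "n = x * y + y * z + z * x" using v par by blast
    then have n: "n = 4 * (a * b + b * c + c * a + a + b + c) + 3" unfolding abc by (simp add: algebra_simps)
    have "even t" if "n = 4 * t + 3" for t using assms that by presburger
    from this[OF n] have "even (a * b + b * c + c * a + a + b + c)" .
    then have "even (a - b)" by auto
    then obtain k where "a - b = 2 * k" by (elim evenE)
    then show ?thesis unfolding abc by (intro exI[of _ k]) simp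
  qed
  have "card ?O \<le> card ?E1"
  proof (rule card_inj_on_le[of ?h])
    show "finite ?E1" by (rule fin) auto
    show "?h ` ?O \<subseteq> ?E1"
    proof (rule image_subsetI)
      fix v assume v: "v \<in> ?O"
      obtain x y z where vv: "v = (x, y, z)" by (cases v) auto
      obtain k where k: "x = y + 4 * k" using cong4[of x y z] v vv by (auto simp: algebra_simps)
      have h: "0 \<le> x" "0 \<le> y" "0 \<le> z" "x * y + y * z + z * x = n" using v by (auto simp: vv triples_def)
      show "?h v \<in> ?E1"
      proof (cases "x \<le> y")
        case True
        have "(y - x) div 2 = - 2 * k" unfolding k by simp
        moreover have "(- 2 * k) * x + x * (x + 2 * z) + (x + 2 * z) * (- 2 * k) = n"
          using h(4) unfolding k by (simp add: algebra_simps)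
        ultimately show ?thesis using True h(1-3) k by (simp add: vv triples_def)
      next
        case False
        have "(x - y) div 2 = 2 * k" unfolding k by simp
        moreover have "(2 * k) * (y + 2 * z) + (y + 2 * z) * y + y * (2 * k) = n"
          using h(4) unfolding k by (simp add: algebra_simps)
        ultimately show ?thesis using False h(1-3) k by (simp add: vv triples_def)
      qed
    qed
    show "inj_on ?h ?O"
    proof (rule inj_onI)
      fix v w assume v: "v \<in> ?O" and w: "w \<in> ?O" and eq: "?h v = ?h w"
      obtain x y z where vv: "v = (x, y, z)" by (cases v) auto
      obtain x' y' z' where ww: "w = (x', y', z')" by (cases w) auto
      obtain k where k: "x = y + 4 * k" using cong4[of x y z] v vv by (auto simp: algebra_simps)
      obtain k' where k': "x' = y' + 4 * k'" using cong4[of x' y' z'] w ww by (auto simp: algebra_simps)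
      have pos: "z > 0" "z' > 0" using v w by (auto simp: vv ww triples_def order_le_less)
      have d: "(y - x) div 2 = - 2 * k" "(x - y) div 2 = 2 * k" "(y' - x') div 2 = - 2 * k'" "(x' - y') div 2 = 2 * k'"
        unfolding k k' by simp_all
      show "v = w"
        using eq pos unfolding vv ww prod.case d by (auto simp: k k' split: if_splits)
    qed
  qed
  moreover have "card ?E1 > 0"
    using one_mem_triples[OF n0] by (subst card_gt_0_iff) (auto intro: fin)
  ultimately show "gsum n > 0" using g O E1 rot by linarith
qed (rule assms)

section \<open>Cauchy's lemma\<close>

text \<open>The last disjunct leaves out the sums of three squares that are divisible by 4.\<close>
definition admissible :: "int \<Rightarrow> int \<Rightarrow> bool" where
  "admissible A B \<longleftrightarrow> odd A \<and> odd B \<or> even A \<and> even B \<and>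
     (let m = A - (B div 2)^2 in m mod 4 = 1 \<or> m mod 4 = 2 \<or> m mod 8 = 3)"

lemma square_mod_8_odd: "odd (x::int) \<Longrightarrow> x^2 mod 8 = 1"
proof -
  assume "odd x"
  then obtain k where x: "x = 2 * k + 1" by (elim oddE)
  have "even (k * (k + 1))" by simp
  then obtain j where "k * (k + 1) = 2 * j" by (elim evenE)
  then have "x^2 = 8 * j + 1" unfolding x by (simp add: power2_eq_square algebra_simps)
  then show ?thesis by simp
qed

lemma square_sum3_le:
  fixes u v w :: int
  shows "(u + v + w)^2 \<le> 3 * (u^2 + v^2 + w^2)"
proof -
  have "3 * (u^2 + v^2 + w^2) - (u + v + w)^2 = (u - v)^2 + (v - w)^2 + (u - w)^2"
    by (simp add: power2_eq_square algebra_simps)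
  then show ?thesis using zero_le_power2[of "u - v"] zero_le_power2[of "v - w"] zero_le_power2[of "u - w"] by linarith
qed

lemma cauchy_aux:
  fixes A B u v w :: int
  assumes sq: "4 * A - B^2 = u^2 + v^2 + w^2" and dvd: "4 dvd B + u + v + w" "even (u + v)" "even (u + w)"
  shows "\<exists>a b c d. a^2 + b^2 + c^2 + d^2 = A \<and> a + b + c + d = B \<and>
    (B \<ge> 0 \<and> 3 * A < B^2 + 2 * B + 4 \<longrightarrow> 0 \<le> a \<and> 0 \<le> b \<and> 0 \<le> c \<and> 0 \<le> d)"
proof -
  obtain a where a: "B + u + v + w = 4 * a" using dvd(1) by (elim dvdE)
  obtain j where j: "u + v = 2 * j" using dvd(2) by (elim evenE)
  obtain k where k: "u + w = 2 * k" using dvd(3) by (elim evenE)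
  \<comment> \<open>These are the quarters of \<open>B\<close> plus \<open>u, v, w\<close> with
    exactly two signs reversed, written so as to be visibly integers.\<close>
  define b c d where "b = a - (j + k - u)" and "c = a - k" and "d = a - j"
  have B: "B = 4 * a - 2 * j - 2 * k + u" and v: "v = 2 * j - u" and w: "w = 2 * k - u" using a j k by simp_all
  have quad: "4 * b = B + u - v - w" "4 * c = B - u + v - w" "4 * d = B - u - v + w"
    unfolding b_def c_def d_def B v w by simp_all
  have "a + b + c + d = B" using a quad by linarith
  moreover have "16 * (a^2 + b^2 + c^2 + d^2) = (4 * a)^2 + (4 * b)^2 + (4 * c)^2 + (4 * d)^2"
    by (simp add: power2_eq_square)
  then have "16 * (a^2 + b^2 + c^2 + d^2) = 4 * B^2 + 4 * (u^2 + v^2 + w^2)"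
    unfolding quad a[symmetric] by (simp add: power2_eq_square algebra_simps)
  then have "16 * (a^2 + b^2 + c^2 + d^2) = 16 * A" unfolding sq[symmetric] by simp
  then have "a^2 + b^2 + c^2 + d^2 = A" by simp
  moreover have "0 \<le> a \<and> 0 \<le> b \<and> 0 \<le> c \<and> 0 \<le> d" if "B \<ge> 0" "3 * A < B^2 + 2 * B + 4"
  proof -
    \<comment> \<open>Each signed sum of \<open>u, v, w\<close> has square at most
      \<open>3 * (4 * A - B^2) < (B + 4)^2\<close>. So \<open>4 * a\<close>, \<open>4 * b\<close>,
      \<open>4 * c\<close> and \<open>4 * d\<close> exceed \<open>-4\<close>, and the integers are
      nonnegative.\<close>
    have lt: "\<bar>t\<bar> < B + 4" if "t^2 \<le> 3 * (u^2 + v^2 + w^2)" for t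
    proof -
      have "\<bar>t\<bar>^2 < (B + 4)^2"
        using that sq \<open>3 * A < B^2 + 2 * B + 4\<close> by (simp add: power2_eq_square algebra_simps)
      then show ?thesis using \<open>B \<ge> 0\<close> power2_less_imp_less[of "\<bar>t\<bar>" "B + 4"] by linarith
    qed
    have "\<bar>u + v + w\<bar> < B + 4" using square_sum3_le by (rule lt)
    moreover have "\<bar>u - v - w\<bar> < B + 4" by (rule lt) (use square_sum3_le[of u "-v" "-w"] in simp)
    moreover have "\<bar>- u + v - w\<bar> < B + 4" by (rule lt) (use square_sum3_le[of "-u" v "-w"] in simp)
    moreover have "\<bar>- u - v + w\<bar> < B + 4" by (rule lt) (use square_sum3_le[of "-u" "-v" w] in simp)
    ultimately show ?thesis using a quad by linarith
  qed
  ultimately show ?thesis by blast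
qed

text \<open>For odd \<open>B\<close> the number \<open>4 * A - B^2\<close> is 3 modulo 8 and hence a
  sum of three odd squares. For even \<open>B\<close> three squares for
  \<open>A - (B div 2)^2\<close> are doubled.\<close>

lemma cauchy_lemma:
  assumes adm: "admissible A B" and le: "B^2 \<le> 4 * A"
  shows "\<exists>a b c d. a^2 + b^2 + c^2 + d^2 = A \<and> a + b + c + d = B \<and>
    (B \<ge> 0 \<and> 3 * A < B^2 + 2 * B + 4 \<longrightarrow> 0 \<le> a \<and> 0 \<le> b \<and> 0 \<le> c \<and> 0 \<le> d)"
proof (cases "odd B")
  case True
  then have odd: "odd A" "odd B" using adm by (auto simp: admissible_def)
  have m: "(4 * A - B^2) mod 8 = 3" using square_mod_8_odd[OF odd(2)] odd(1) by presburger
  then obtain u v w where uvw: "4 * A - B^2 = u^2 + v^2 + w^2"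
    using three_squares_mod8[of "4 * A - B^2"] le by auto
  have sq4: "x^2 mod 4 = (if even x then 0 else 1)" for x :: int
    using square_mod_8_odd[of x] by (auto elim!: evenE simp: power2_eq_square) presburger
  have "odd u \<and> odd v \<and> odd w"
    using m sq4[of u] sq4[of v] sq4[of w] unfolding uvw by (auto split: if_splits) presburger+
  then have o: "odd u" "odd v" "odd w" by auto
  \<comment> \<open>The sum \<open>B + u + v + w\<close> is even, and reversing the sign of the odd
    \<open>w\<close> changes it by 2 modulo 4.\<close>
  obtain w' where w': "w'^2 = w^2" "odd w'" "4 dvd B + u + v + w'"
  proof (cases "4 dvd B + u + v + w")
    case True
    then show ?thesis using that[of w] o by simp
  next
    case False
    then have "4 dvd B + u + v - w" using o odd by presburger
    then show ?thesis using that[of "- w"] o by simp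
  qed
  show ?thesis by (rule cauchy_aux[of A B u v w']) (use uvw w' o in auto)
next
  case False
  then have ev: "even A" "even B" and
    m: "(A - (B div 2)^2) mod 4 = 1 \<or> (A - (B div 2)^2) mod 4 = 2 \<or> (A - (B div 2)^2) mod 8 = 3"
    using adm by (auto simp: admissible_def Let_def)
  obtain b where b: "B = 2 * b" using ev(2) by (elim evenE)
  have "A - b^2 \<ge> 0" using le unfolding b by (simp add: power2_eq_square)
  moreover have "(A - b^2) mod 4 = 1 \<or> (A - b^2) mod 4 = 2 \<or> (A - b^2) mod 8 = 3" using m b by auto
  ultimately obtain u v w where uvw: "A - b^2 = u^2 + v^2 + w^2"
    using three_squares_mod4[of "A - b^2"] three_squares_mod8[of "A - b^2"] by blast
  then have A: "A = b^2 + u^2 + v^2 + w^2" by simp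
  have "even (b + u + v + w)" using ev(1) unfolding A by simp
  then have "4 dvd B + 2 * u + 2 * v + 2 * w" unfolding b by presburger
  moreover have "4 * A - B^2 = (2 * u)^2 + (2 * v)^2 + (2 * w)^2" using uvw unfolding b by (simp add: power2_eq_square)
  ultimately show ?thesis by (intro cauchy_aux[of A B "2 * u" "2 * v" "2 * w"]) auto
qed

section \<open>Finite verification\<close>

text \<open>The congruence part of Cauchy's lemma for \<open>A = (r - b * B) / a\<close>. The size
  conditions are kept apart so that \<open>r\<close> may be a residue of \<open>n\<close>.\<close>

definition fits :: "int \<Rightarrow> int \<Rightarrow> int \<Rightarrow> int \<Rightarrow> bool" where
  "fits a b r B \<longleftrightarrow> (r - b * B) mod a = 0 \<and> admissible ((r - b * B) div a) B"

lemma admissible_shift: "admissible (A + 8 * k) (B + 32 * j) = admissible A B"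
proof -
  have d: "(B + 32 * j) div 2 = B div 2 + 16 * j" by simp
  have m: "A + 8 * k - ((B + 32 * j) div 2)^2
    = A - (B div 2)^2 + 8 * (k - 4 * (B div 2) * j - 32 * j^2)"
    unfolding d by (simp add: power2_eq_square algebra_simps)
  have mods: "(t + 8 * l) mod 8 = t mod 8" "(t + 8 * l) mod 4 = t mod 4" for t l :: int by presburger+
  show ?thesis unfolding admissible_def Let_def m mods by simp
qed

text \<open>The hypothesis on \<open>l\<close> ensures that \<open>A\<close> changes by a multiple
  of 8. The case \<open>j = l = 0\<close> reduces \<open>n\<close> alone; for \<open>a = 4\<close>
  the choice \<open>l = b * j\<close> also reduces \<open>B\<close> modulo 32.\<close>

lemma fits_shift:
  assumes "a > 0" "32 * b * j = 8 * a * l"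
  shows "fits a b (r + 8 * a * q) (B + 32 * j) = fits a b r B"
proof -
  define k where "k = q - l"
  have e: "r + 8 * a * q - b * (B + 32 * j) = r - b * B + a * (8 * k)"
    using assms(2) by (simp add: k_def algebra_simps)
  have "(r - b * B + a * (8 * k)) div a = (r - b * B) div a + 8 * k"
    using assms(1) by simp
  then show ?thesis unfolding fits_def e by (simp add: admissible_shift)
qed

lemma fits_imp_rep:
  assumes "fits a b n B" "a > 0" "a * B^2 \<le> 4 * (n - b * B)"
  shows "\<exists>w x y z. n = w * (a * w + b) + x * (a * x + b) + y * (a * y + b) + z * (a * z + b) \<and>
    (B \<ge> 0 \<and> 3 * (n - b * B) < a * (B^2 + 2 * B + 4) \<longrightarrow> 0 \<le> w \<and> 0 \<le> x \<and> 0 \<le> y \<and> 0 \<le> z)"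
proof -
  define A where "A = (n - b * B) div a"
  have A: "n - b * B = a * A" and adm: "admissible A B" using assms(1) by (auto simp: fits_def A_def)
  have "B^2 \<le> 4 * A" using assms(2,3) unfolding A by (simp add: mult.left_commute[of 4])
  from cauchy_lemma[OF adm this] obtain w x y z where r: "w^2 + x^2 + y^2 + z^2 = A" "w + x + y + z = B"
    "B \<ge> 0 \<and> 3 * A < B^2 + 2 * B + 4 \<longrightarrow> 0 \<le> w \<and> 0 \<le> x \<and> 0 \<le> y \<and> 0 \<le> z" by blast
  have "n = a * A + b * B" using A by simp
  then have "n = w * (a * w + b) + x * (a * x + b) + y * (a * y + b) + z * (a * z + b)"
    unfolding r(1,2)[symmetric] by (simp add: power2_eq_square algebra_simps)
  moreover have "3 * A < B^2 + 2 * B + 4" if "3 * (n - b * B) < a * (B^2 + 2 * B + 4)"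
    using that assms(2) unfolding A by (simp add: mult.left_commute[of 3])
  ultimately show ?thesis using r(3) by blast
qed

text \<open>The bound on \<open>n\<close> gives \<open>B^2 \<le> 4 * A\<close> for all
  \<open>\<bar>B\<bar> \<le> K\<close> at once, so only congruences remain to be met.\<close>

lemma mem_T_of_large:
  assumes res: "\<forall>r\<in>set [0..8 * a - 1]. \<exists>B\<in>set [-K..K]. fits a b r B"
    and a: "a > 0" and b: "b \<ge> 0" and n: "a * K^2 + 4 * b * K \<le> 4 * n"
  shows "n \<in> T a b"
proof -
  define r q where "r = n mod (8 * a)" and "q = n div (8 * a)"
  have nrq: "n = r + 8 * a * q" by (simp add: r_def q_def)
  have "r \<in> set [0..8 * a - 1]" using a by (simp add: r_def)
  then obtain B where B: "- K \<le> B" "B \<le> K" "fits a b r B" using res by fastforce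
  then have "fits a b n B" using fits_shift[of a b 0 0 r q B] a by (simp add: nrq)
  moreover have "a * B^2 \<le> 4 * (n - b * B)"
  proof -
    have "\<bar>B\<bar>^2 \<le> K^2" using B by (intro power_mono) auto
    then have "a * B^2 \<le> a * K^2" using a by simp
    moreover have "4 * (b * B) \<le> 4 * (b * K)" using B b by (simp add: mult_left_mono)
    ultimately show ?thesis using n by (simp add: right_diff_distrib)
  qed
  ultimately show ?thesis using fits_imp_rep[of a b n B] a unfolding T_def by blast
qed

section \<open>Search for the gaps of \<open>T\<close> among small numbers\<close>

definition pairs :: "int \<Rightarrow> int \<Rightarrow> int \<Rightarrow> int \<Rightarrow> int list" where
  "pairs a b K N = remdups (filter (\<lambda>p. p \<le> N)
     (concat (map (\<lambda>w. map (\<lambda>x. w * (a * w + b) + x * (a * x + b)) [w..K]) [-K..K])))"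

definition misses :: "int list \<Rightarrow> int list \<Rightarrow> int list" where
  "misses ps = filter (\<lambda>n. \<not> list_ex (\<lambda>p. n - p \<in> set ps) ps)"

lemma summand_nonneg:
  fixes a b w :: int
  assumes "0 \<le> b" "b \<le> a"
  shows "0 \<le> w * (a * w + b)"
proof (cases "w \<ge> 0")
  case True then show ?thesis using assms by simp
next
  case False
  then have "a * w \<le> a * (-1)" using assms by (intro mult_left_mono) auto
  then have "a * w + b \<le> 0" using assms by linarith
  then show ?thesis using False by (intro mult_nonpos_nonpos) auto
qed

text \<open>The bound is the summand at \<open>w = -(K + 1)\<close>, the smallest one with
  \<open>\<bar>w\<bar> > K\<close>.\<close>

lemma summand_bound:
  fixes a b w K :: int
  assumes "0 \<le> b" "b \<le> a" "0 \<le> K" "w * (a * w + b) < (K + 1) * (a * (K + 1) - b)"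
  shows "\<bar>w\<bar> \<le> K"
proof (rule ccontr)
  assume "\<not> \<bar>w\<bar> \<le> K"
  then have w: "K + 1 \<le> \<bar>w\<bar>" by simp
  have "a * (K + 1) \<le> a * \<bar>w\<bar>" using w assms by (intro mult_left_mono) auto
  moreover have "a * 1 \<le> a * (K + 1)" using assms by (intro mult_left_mono) auto
  ultimately have "(K + 1) * (a * (K + 1) - b) \<le> \<bar>w\<bar> * (a * \<bar>w\<bar> - b)"
    using w assms by (intro mult_mono) auto
  also have "\<dots> \<le> w * (a * w + b)"
    using assms by (cases "w \<ge> 0") (auto simp: algebra_simps mult_left_mono)
  finally show False using assms by simp
qed

lemma set_pairs:
  assumes "0 \<le> b" "b \<le> a" "0 \<le> K" "N < (K + 1) * (a * (K + 1) - b)"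
  shows "set (pairs a b K N) = {p. p \<le> N \<and> (\<exists>w x. p = w * (a * w + b) + x * (a * x + b))}"
proof (rule set_eqI)
  fix p
  have mem: "p \<in> set (pairs a b K N) \<longleftrightarrow>
      p \<le> N \<and> (\<exists>w\<in>{-K..K}. \<exists>x\<in>{w..K}. p = w * (a * w + b) + x * (a * x + b))"
    unfolding pairs_def by auto
  have "\<exists>w\<in>{-K..K}. \<exists>x\<in>{w..K}. p = w * (a * w + b) + x * (a * x + b)"
    if p: "p \<le> N" "p = w * (a * w + b) + x * (a * x + b)" "w \<le> x" for w x
  proof -
    have "w * (a * w + b) \<le> N" "x * (a * x + b) \<le> N"
      using p summand_nonneg[OF assms(1,2), of w] summand_nonneg[OF assms(1,2), of x] by linarith+
    then have "\<bar>w\<bar> \<le> K" "\<bar>x\<bar> \<le> K"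
      using assms(4) by (meson le_less_trans summand_bound[OF assms(1,2,3)])+
    then have "w \<in> {-K..K}" "x \<in> {w..K}" using p(3) by auto
    then show ?thesis using p(2) by blast
  qed
  moreover have "\<exists>w x. w \<le> x \<and> p = w * (a * w + b) + x * (a * x + b)"
    if "p = w * (a * w + b) + x * (a * x + b)" for w x
    using that by (metis add.commute linear)
  ultimately show "p \<in> set (pairs a b K N) \<longleftrightarrow>
      p \<in> {p. p \<le> N \<and> (\<exists>w x. p = w * (a * w + b) + x * (a * x + b))}"
    unfolding mem mem_Collect_eq by blast
qed

text \<open>The summands are nonnegative, so in a representation of \<open>n \<le> N\<close> both
  two-term halves are at most \<open>N\<close> and appear in \<open>pairs\<close>.\<close>

lemma mem_T_iff_not_miss:
  assumes "0 \<le> b" "b \<le> a" "0 \<le> K" "N < (K + 1) * (a * (K + 1) - b)" and n: "l \<le> n" "n \<le> N"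
  shows "n \<in> T a b \<longleftrightarrow> n \<notin> set (misses (pairs a b K N) [l..N])"
proof -
  let ?P = "{p. p \<le> N \<and> (\<exists>w x. p = w * (a * w + b) + x * (a * x + b))}"
  have "n \<in> T a b \<longleftrightarrow> (\<exists>p\<in>?P. n - p \<in> ?P)"
  proof
    assume "n \<in> T a b"
    then obtain w x y z where n': "n = w * (a * w + b) + x * (a * x + b) + y * (a * y + b) + z * (a * z + b)"
      unfolding T_def by blast
    note nn = summand_nonneg[OF assms(1,2)]
    have "w * (a * w + b) + x * (a * x + b) \<in> ?P" "n - (w * (a * w + b) + x * (a * x + b)) \<in> ?P"
      using n(2) nn[of w] nn[of x] nn[of y] nn[of z] unfolding n' by auto
    then show "\<exists>p\<in>?P. n - p \<in> ?P" by blast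
  next
    assume "\<exists>p\<in>?P. n - p \<in> ?P"
    then obtain p w x y z where "p = w * (a * w + b) + x * (a * x + b)" "n - p = y * (a * y + b) + z * (a * z + b)"
      by blast
    then have "n = w * (a * w + b) + x * (a * x + b) + y * (a * y + b) + z * (a * z + b)" by simp
    then show "n \<in> T a b" unfolding T_def by blast
  qed
  then show ?thesis using n unfolding misses_def set_pairs[OF assms(1-4), symmetric]
    by (simp add: list_ex_iff)
qed

lemma int_mem_Nats_iff: "n \<in> \<nat> \<longleftrightarrow> 0 \<le> n" for n :: int
proof
  assume "0 \<le> n"
  then have "n = of_nat (nat n)" by simp
  then show "n \<in> \<nat>" by (metis of_nat_in_Nats)
qed (auto elim: Nats_cases)

lemma T_subset_Nats: assumes "0 \<le> b" "b \<le> a" shows "T a b \<subseteq> \<nat>"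
  using summand_nonneg[OF assms] unfolding T_def by (auto simp: int_mem_Nats_iff intro!: add_nonneg_nonneg)

lemma Max_gaps:
  assumes "m \<ge> 0" "m \<notin> T a b" "\<And>n. n > m \<Longrightarrow> n \<in> T a b"
  shows "finite (\<nat> - T a b) \<and> \<nat> - T a b \<noteq> {} \<and> Max (\<nat> - T a b) = m"
proof -
  have m: "m \<in> \<nat> - T a b" using assms(1,2) by (simp add: int_mem_Nats_iff)
  have "n \<le> m" if "n \<notin> T a b" for n using assms(3)[of n] that by linarith
  then have sub: "\<nat> - T a b \<subseteq> {0..m}" by (auto simp: int_mem_Nats_iff)
  then have fin: "finite (\<nat> - T a b)" by (rule finite_subset) simp
  have "Max (\<nat> - T a b) = m" by (rule Max_eqI[OF fin _ m]) (use sub in auto)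
  then show ?thesis using fin m by blast
qed

text \<open>For these \<open>B\<close> the conditions of Cauchy's lemma on \<open>n\<close> read \<open>l \<le> n\<close> and \<open>3 * n < h\<close>.\<close>
definition windows :: "int \<Rightarrow> int \<Rightarrow> (int \<times> int) list" where
  "windows b r = map (\<lambda>B. (B * B + b * B, 4 * (B * B) + (8 + 3 * b) * B + 16)) (filter (fits 4 b r) [38..122])"

definition quad_value :: "int \<Rightarrow> int \<times> int \<times> int \<times> int \<Rightarrow> int" where
  "quad_value b = (\<lambda>(w, x, y, z). w * (4 * w + b) + x * (4 * x + b) + y * (4 * y + b) + z * (4 * z + b))"

text \<open>The first disjunct excuses numbers below the claimed threshold
  \<open>n0\<close>.\<close>

definition covered :: "int \<Rightarrow> (int \<times> int) list \<Rightarrow> int list \<Rightarrow> int \<Rightarrow> bool" where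
  "covered n0 ws vs n \<longleftrightarrow> n < n0 \<or> list_ex (\<lambda>(l, h). l \<le> n \<and> 3 * n < h) ws \<or> n \<in> set vs"

text \<open>For \<open>0 \<le> r < 32\<close> these are the numbers with residue \<open>r\<close>
  modulo 32 in \<open>2048 \<le> n < 14848\<close>. For \<open>b = 1\<close> and
  \<open>b = - 1\<close> the range \<open>[38..122]\<close> in \<open>windows\<close> contains every
  nonnegative \<open>B\<close> whose window meets this interval.\<close>

definition all_covered :: "int \<Rightarrow> int \<Rightarrow> (int \<times> int) list \<Rightarrow> int list \<Rightarrow> bool" where
  "all_covered n0 r ws vs \<longleftrightarrow>
     list_all (\<lambda>j. list_all (\<lambda>i. covered n0 ws vs (512 * j + 32 * i + r)) [0..15]) [4..28]"

definition cover_check :: "int \<Rightarrow> int \<Rightarrow> int \<times> (int \<times> int \<times> int \<times> int) list \<Rightarrow> bool" where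
  "cover_check n0 b = (\<lambda>(r, qs). list_all (\<lambda>(w, x, y, z). 0 \<le> w \<and> 0 \<le> x \<and> 0 \<le> y \<and> 0 \<le> z) qs \<and>
     all_covered n0 r (windows b r) (map (quad_value b) qs))"

text \<open>Representations of the \<open>n\<close> that lie in no window, listed by the residue of \<open>n\<close> modulo 32.\<close>
definition quads_plus :: "(int \<times> (int \<times> int \<times> int \<times> int) list) list" where
  "quads_plus = [
   (0, [(5,6,8,21), (4,6,9,21), (0,0,10,22), (2,8,9,21), (2,2,4,24), (0,4,4,24), (0,2,6,24), (1,6,12,21),
     (4,6,7,23), (0,0,8,24), (2,7,8,23), (3,4,10,23), (5,5,6,24), (3,6,7,24), (2,7,7,24), (2,2,2,26),
     (0,2,4,26), (4,5,6,25), (0,0,6,26), (2,5,8,25), (2,4,9,25), (0,3,14,23), (4,5,5,26), (3,4,7,26),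
     (3,3,8,26), (1,5,8,26), (1,4,9,26), (0,5,9,26), (1,7,9,31), (3,3,11,31), (1,2,4,33), (0,2,5,33),
     (0,1,6,33), (7,9,10,30), (1,3,13,31), (5,10,11,30), (6,7,13,30), (5,5,5,33), (1,1,4,34), (0,1,5,34),
     (3,3,9,33), (1,5,9,33), (6,6,13,31), (4,8,13,31), (1,3,11,33), (1,10,15,30), (0,2,3,35), (5,7,12,32),
     (1,12,12,31), (1,1,13,33), (7,8,8,33), (6,7,10,33), (3,5,5,35), (3,3,7,35), (1,1,2,36), (0,12,14,38),
     (2,3,10,41), (6,8,10,40), (2,2,11,41), (0,4,11,41), (0,1,15,40), (3,5,6,42), (2,5,7,42), (1,6,7,42),
     (1,1,3,43), (2,8,14,40), (1,3,10,42), (0,6,20,38), (1,2,11,42), (2,6,16,40), (4,4,5,43), (2,5,6,43),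
     (1,6,6,43), (1,4,8,43), (2,2,9,43), (0,2,12,50), (1,5,18,48), (7,7,8,50), (5,8,9,50), (4,9,9,50),
     (4,7,11,50), (0,0,14,50), (3,7,12,50), (0,1,3,52)]),
   (1, []),
   (2, [(0,0,1,25), (2,6,10,32), (0,4,16,30), (1,3,4,34), (0,3,5,34), (3,7,7,33), (0,1,7,34), (8,8,11,31),
     (1,7,9,33), (3,3,11,33), (1,5,11,33), (1,2,4,35), (0,2,5,35), (0,1,6,35), (1,3,13,33), (2,4,10,34),
     (0,8,8,34), (0,6,10,34), (5,5,5,35), (1,2,3,36), (0,4,12,34), (3,3,9,35), (1,5,9,35), (4,8,13,33),
     (5,6,14,33), (1,3,11,35), (4,4,6,36), (2,6,6,36), (4,5,15,50), (0,7,18,49), (6,8,9,51), (5,8,10,51),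
     (4,9,10,51), (5,6,12,51), (1,2,2,53)]),
   (3, []),
   (4, [(0,2,10,24), (3,7,12,22), (4,7,10,23), (4,6,11,23), (2,4,4,26), (2,2,6,26), (0,0,1,27), (3,7,10,24),
     (0,2,8,26), (5,6,8,25), (4,6,9,25), (4,5,10,25), (0,0,10,26), (1,6,13,24), (5,5,8,26), (4,5,9,26),
     (2,2,4,28), (0,4,4,28), (0,2,6,28), (4,6,7,27), (3,6,8,27), (0,0,8,28), (3,4,10,27), (1,4,13,26),
     (5,5,6,28), (3,6,7,28), (2,7,7,28), (2,5,9,28), (3,3,10,28), (3,5,11,33), (2,3,4,35), (1,7,11,33),
     (0,3,6,35), (0,2,7,35), (1,5,13,33), (0,0,0,36), (7,9,12,32), (7,8,13,32), (2,3,3,36), (1,2,5,36),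
     (1,1,6,36), (3,5,9,35), (7,8,12,33), (1,7,9,35), (3,3,11,35), (1,5,11,35), (1,1,17,33), (1,2,4,37),
     (0,2,5,37), (0,1,6,37), (6,7,13,34), (3,8,16,33), (5,7,14,34), (8,8,9,35), (5,5,5,37), (1,6,10,43),
     (0,8,9,43), (6,10,10,42), (1,4,12,43), (0,5,12,43), (4,5,7,44), (3,5,8,44), (1,3,3,45), (1,1,5,45),
     (2,12,12,42), (0,7,9,44), (1,4,11,44), (0,5,11,44), (1,3,12,44), (10,12,13,41), (4,4,7,45), (3,4,8,45),
     (4,4,18,42), (2,8,15,51), (0,2,14,52), (6,7,11,52), (0,11,14,51)]),
   (5, [(5,5,10,21), (3,7,10,21)]),
   (6, [(2,3,5,36), (1,3,6,36), (1,2,7,36), (5,5,9,35), (3,7,9,35), (2,4,14,34), (3,5,11,35), (1,9,9,35),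
     (2,3,4,37), (6,6,6,36), (0,3,6,37), (0,2,7,37), (4,4,10,36), (2,6,10,36), (6,9,13,34), (7,7,14,34),
     (2,4,12,36), (1,3,4,38), (0,3,5,38), (3,5,9,37), (0,1,7,38), (1,7,9,37), (3,3,11,37), (1,5,11,37),
     (8,9,9,36), (2,9,15,52), (7,8,10,53), (6,8,11,53)]),
   (7, [(0,3,8,24)]),
   (8, [(1,2,6,23), (4,4,12,20), (6,8,9,25), (5,8,10,25), (0,2,12,26), (4,4,4,28), (2,4,6,28), (0,0,3,29),
     (2,2,8,28), (0,4,8,28), (0,0,14,26), (6,7,8,27), (0,2,10,28), (4,7,10,27), (4,6,11,27), (1,8,13,26),
     (6,7,7,28), (0,0,12,28), (2,4,4,30), (2,2,6,30), (0,4,6,30), (0,0,1,31), (0,2,8,30), (4,6,9,29),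
     (4,5,10,29), (2,8,9,29), (0,0,10,30), (1,8,10,29), (5,5,8,30), (4,5,9,30), (2,4,5,37), (1,4,6,37),
     (0,5,6,37), (1,2,8,37), (0,0,2,38), (0,2,9,37), (9,10,11,34), (0,1,10,37), (3,3,4,38), (1,4,5,38),
     (0,5,5,38), (0,3,7,38), (1,1,8,38), (8,9,12,35), (0,1,9,38), (1,9,9,37), (1,7,11,37), (2,3,4,39),
     (3,3,13,37), (0,3,6,39), (0,2,7,39), (7,8,13,36), (5,11,12,36), (0,0,0,40), (1,3,15,37), (3,4,12,45),
     (1,3,16,44), (0,8,11,45), (0,7,12,45), (5,6,7,46), (3,3,3,47), (1,3,5,47), (3,5,10,46), (1,1,7,47),
     (2,5,11,46), (1,6,11,46), (2,12,14,44), (0,3,16,45), (2,3,13,46), (5,6,6,47), (8,9,9,54)]),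
   (9, []),
   (10, [(3,4,4,23), (0,0,2,24), (2,2,7,23), (0,4,7,23), (0,3,8,23), (3,3,4,24), (1,4,5,24), (0,5,5,24),
     (2,10,10,36), (1,4,7,38), (1,3,8,38), (5,7,9,37), (0,3,9,38), (5,5,11,37), (3,7,11,37), (0,8,14,36),
     (2,4,5,39), (1,4,6,39), (0,5,6,39), (1,2,8,39), (4,6,10,38), (0,2,9,39), (2,8,10,38), (0,1,10,39),
     (2,6,12,38), (2,3,5,40), (1,3,6,40), (1,2,7,40), (3,7,9,39), (1,3,17,37), (3,5,11,39), (1,9,9,39)]),
   (11, []),
   (12, [(2,5,7,22), (1,6,7,22), (2,3,9,22), (4,4,5,23), (2,5,6,23), (1,6,6,23), (1,4,8,23), (2,2,9,23),
     (1,1,1,25), (1,2,10,23), (1,4,7,24), (1,3,8,24), (6,6,10,22), (3,4,4,25), (2,3,6,25), (0,4,12,28),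
     (6,8,11,27), (6,7,12,27), (1,2,2,31), (0,1,4,31), (0,0,5,31), (6,7,11,28), (0,6,8,30), (2,2,10,30),
     (0,4,10,30), (6,8,9,29), (0,1,3,32), (4,9,10,29), (0,2,12,30), (3,6,15,28), (7,7,8,30), (4,4,4,32),
     (2,4,6,32), (4,7,11,30), (0,0,3,33), (0,4,8,32), (6,7,8,31), (0,9,14,29), (0,2,10,32), (4,6,11,31),
     (0,11,11,30), (3,6,12,31), (6,7,7,32), (2,3,8,39), (0,2,2,40), (0,0,4,40), (1,9,13,37), (0,3,10,39),
     (6,9,19,34), (0,2,11,39), (3,3,6,40), (2,3,7,40), (7,7,7,39), (5,7,9,39), (1,2,9,40), (5,5,11,39),
     (1,1,10,40), (7,12,12,37), (7,10,14,37), (2,4,5,41), (1,4,6,41), (0,5,6,41), (1,2,8,41), (4,12,15,37),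
     (0,0,2,42), (2,6,13,47), (8,10,12,46), (2,5,14,47), (3,3,5,49), (1,5,5,49), (1,3,7,49), (4,5,11,48),
     (6,8,16,46), (1,1,9,49), (1,8,11,48), (0,1,1,50), (0,9,11,48)]),
   (13, [(1,1,8,23), (3,3,3,24)]),
   (14, [(2,6,9,21), (5,5,6,22), (3,6,7,22), (2,2,2,24), (0,2,4,24), (3,3,10,22), (0,0,6,24), (3,4,8,23),
     (0,4,13,21), (1,1,3,25), (4,5,5,24), (3,4,7,24), (3,3,8,24), (1,5,8,24), (1,4,9,24), (0,2,2,26),
     (0,0,4,26), (1,6,6,25), (1,4,8,25), (2,2,9,25), (0,4,9,25), (1,1,1,27), (1,6,7,40), (2,3,9,40),
     (7,7,9,39), (1,3,10,40), (0,1,14,39), (1,2,11,40), (3,9,11,39), (3,4,6,41), (2,4,7,41), (2,3,8,41),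
     (0,6,7,41), (6,6,10,40), (4,8,10,40), (0,3,10,41), (4,6,12,40), (0,2,11,41), (3,4,5,42), (7,10,15,38),
     (1,4,7,42), (1,3,8,42), (0,10,12,40), (0,3,9,42)]),
   (15, [(0,1,11,23)]),
   (16, [(1,3,5,23), (4,7,8,21), (1,1,7,23), (3,6,10,21), (5,6,7,22), (2,6,11,21), (3,6,9,22), (3,5,10,22),
     (5,6,6,23), (4,5,8,23), (1,3,3,25), (1,1,5,25), (2,5,10,23), (4,5,7,24), (3,5,8,24), (3,4,9,24),
     (1,7,8,24), (0,5,12,23), (4,4,7,25), (3,4,8,25), (0,5,11,24), (1,3,12,24), (1,1,3,27), (3,5,6,26),
     (2,5,7,26), (1,6,7,26), (2,3,9,26), (0,3,12,25), (4,4,5,27), (8,9,10,29), (6,7,15,28), (2,2,3,33),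
     (0,3,4,33), (4,4,8,32), (2,6,8,32), (0,0,7,33), (2,4,10,32), (0,8,8,32), (0,6,10,32), (1,2,3,34),
     (2,2,12,32), (0,4,12,32), (6,7,12,31), (4,10,11,31), (5,5,16,30), (3,10,12,31), (4,4,6,34), (1,2,2,35),
     (0,1,4,35), (0,0,5,35), (0,6,8,34), (2,2,10,34), (0,4,10,34), (5,8,10,33), (4,9,10,33), (5,6,12,33),
     (0,2,4,42), (10,11,14,37), (0,0,6,42), (0,5,10,41), (1,11,13,39), (7,12,16,37), (4,5,5,42), (3,4,7,42),
     (3,3,8,42), (1,5,8,42), (1,4,9,42), (0,5,9,42), (0,1,14,41), (7,10,17,38), (0,3,11,42), (5,5,13,41),
     (3,4,6,43), (2,4,7,43), (2,3,8,43), (0,6,7,43), (0,2,2,44), (2,7,14,49), (3,5,5,51), (3,3,7,51),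
     (1,5,7,51), (5,6,11,50), (1,3,9,51), (6,10,16,48), (1,1,2,52)]),
   (17, []),
   (18, [(2,2,6,24), (0,4,6,24), (5,5,10,22), (0,2,8,24), (3,3,3,25), (1,3,5,25), (3,8,8,23), (1,1,7,25),
     (4,4,11,23), (5,5,8,24), (2,2,4,26), (0,4,4,26), (0,2,6,26), (5,6,6,25), (4,5,8,25), (0,0,8,26),
     (1,3,3,27), (1,1,5,27), (5,5,6,26), (3,6,7,26), (2,7,7,26), (2,5,9,26), (2,2,2,28), (0,2,4,28),
     (4,4,7,27), (0,0,6,28), (1,2,14,25), (1,1,16,24), (2,3,10,27), (0,3,14,41), (0,7,9,42), (1,4,11,42),
     (0,5,11,42), (1,3,12,42), (4,5,6,43), (3,11,11,41), (2,5,8,43), (2,4,9,43), (8,8,8,42), (1,4,10,43),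
     (0,5,10,43), (6,6,12,42), (0,1,15,42), (1,2,12,43), (3,5,6,44), (2,5,7,44), (1,6,7,44), (2,3,9,44)]),
   (19, []),
   (20, [(1,3,7,25), (5,6,10,23), (3,6,13,22), (1,1,9,25), (5,7,8,24), (4,7,9,24), (3,8,9,24), (4,5,11,24),
     (6,6,7,25), (3,3,3,27), (1,3,5,27), (3,6,10,25), (1,1,7,27), (5,6,7,26), (3,4,12,25), (3,6,9,26),
     (3,5,10,26), (0,7,12,25), (5,6,6,27), (4,5,8,27), (4,4,9,27), (2,6,9,27), (1,3,3,29), (1,1,5,29),
     (4,5,7,28), (3,5,8,28), (3,4,9,28), (1,7,8,28), (8,10,11,31), (2,2,5,35), (1,2,6,35), (4,6,8,34),
     (5,8,17,30), (0,1,8,35), (2,6,10,34), (0,0,9,35), (6,9,13,32), (1,3,4,36), (0,3,5,36), (0,6,12,34),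
     (0,1,7,36), (6,9,12,33), (2,2,14,34), (0,4,14,34), (5,8,14,33), (2,2,3,37), (0,3,4,37), (2,6,8,36),
     (5,9,12,34), (0,0,7,37), (0,8,8,36), (0,6,10,36), (7,8,10,35), (2,2,12,36), (5,7,15,41), (2,4,11,43),
     (0,0,8,44), (2,3,12,43), (1,7,21,39), (5,5,6,44), (3,6,7,44), (2,7,7,44), (2,5,9,44), (3,3,10,44),
     (1,5,10,44), (2,3,11,44), (0,2,15,43), (7,12,17,40), (5,7,13,43), (4,5,6,45), (1,2,13,44), (2,5,8,45),
     (3,5,7,53), (7,8,9,52), (3,3,9,53), (1,5,9,53), (5,7,12,52)]),
   (21, [(0,2,8,23)]),
   (22, [(7,7,8,24), (2,2,8,26), (0,4,8,26), (4,7,11,24), (3,3,5,27), (1,5,5,27), (1,3,7,27), (2,6,15,23),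
     (1,9,12,24), (1,1,9,27), (2,4,4,28), (2,2,6,28), (0,4,6,28), (3,6,11,26), (0,2,8,28), (4,7,8,27),
     (3,3,3,29), (1,3,5,29), (0,0,10,28), (1,1,7,29), (5,5,8,28), (4,5,9,28), (0,8,11,27), (2,2,4,30),
     (0,4,4,30), (0,2,6,30), (4,5,8,29), (4,4,9,29), (0,0,8,30), (2,5,11,44), (1,6,11,44), (7,9,11,43),
     (1,2,16,43), (2,3,13,44), (4,6,7,45), (3,6,8,45), (2,7,8,45), (3,4,10,45), (2,8,18,42), (2,4,11,45),
     (0,7,10,45), (2,3,12,45), (5,5,17,43), (4,10,12,44), (4,5,7,46), (3,5,8,46)]),
   (23, [(0,0,13,22)]),
   (24, [(0,1,9,22), (0,0,0,24), (1,5,7,27), (6,7,10,25), (1,3,9,27), (4,8,11,25), (4,7,12,25), (0,1,2,29),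
     (1,1,11,27), (5,6,11,26), (3,9,10,26), (2,7,14,25), (3,3,5,29), (1,5,5,29), (0,1,1,30), (3,5,14,26),
     (4,5,12,27), (1,1,9,29), (4,7,9,28), (3,8,9,28), (4,5,11,28), (2,5,14,27), (6,6,7,29), (4,7,8,29),
     (3,8,8,29), (3,3,3,31), (1,3,5,31), (2,6,11,29), (1,1,7,31), (4,10,18,24), (3,6,9,30), (2,3,6,37),
     (2,2,7,37), (0,4,7,37), (0,3,8,37), (4,6,10,36), (5,12,14,33), (2,8,10,36), (4,4,12,36), (2,3,5,38),
     (1,3,6,38), (1,2,7,38), (0,8,12,36), (2,4,14,36), (7,10,12,35), (0,6,14,36), (7,8,14,35), (4,9,17,34),
     (2,2,5,39), (1,2,6,39), (0,4,16,36), (4,4,10,38), (0,1,8,39), (7,7,14,36), (0,0,9,39), (2,5,12,45),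
     (0,0,1,47), (0,0,10,46), (7,13,20,40), (5,5,8,46), (4,5,9,46), (0,5,14,45), (11,13,14,42), (3,4,11,46),
     (9,9,9,45), (3,3,12,46), (1,5,12,46), (7,7,13,45), (1,4,13,46), (4,6,7,47)]),
   (25, []),
   (26, [(1,3,6,24), (0,2,14,26), (0,6,8,28), (2,2,10,28), (3,5,5,29), (0,1,3,30), (1,5,7,29), (6,6,11,27),
     (1,3,9,29), (4,7,12,27), (4,4,4,30), (2,4,6,30), (0,1,2,31), (2,2,8,30), (0,4,8,30), (3,7,12,28),
     (6,6,9,29), (3,3,5,31), (1,5,5,31), (1,3,7,31), (4,5,12,29), (6,7,7,30), (1,1,9,31), (5,5,10,30),
     (2,4,4,32), (2,2,6,32), (0,4,6,32), (6,6,7,31), (0,2,8,32), (0,1,1,48), (3,4,13,46), (0,9,11,46),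
     (7,9,13,45), (5,6,8,47), (4,6,9,47), (4,5,10,47), (2,8,9,47), (0,5,15,46), (1,8,10,47), (2,5,12,47),
     (1,6,12,47), (0,0,1,49), (3,9,17,45)]),
   (27, []),
   (28, [(3,3,8,22), (1,5,8,22), (0,2,2,24), (0,0,4,24), (2,4,7,23), (2,3,8,23), (0,6,7,23), (7,7,9,21),
     (3,3,6,24), (2,3,7,24), (3,7,15,19), (0,2,11,23), (1,2,9,24), (2,4,5,25), (0,0,2,26), (3,3,9,29),
     (1,5,9,29), (1,1,15,27), (5,8,12,27), (0,2,3,31), (7,8,9,28), (5,6,14,27), (5,8,11,28), (5,7,12,28),
     (1,1,13,29), (3,5,5,31), (1,1,2,32), (1,5,7,31), (4,8,11,29), (1,3,9,31), (3,8,12,29), (6,7,9,30),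
     (5,7,10,30), (1,1,11,31), (0,1,2,33), (4,4,15,29), (2,9,11,30), (6,6,9,31), (5,6,10,31), (3,3,5,33),
     (1,5,5,33), (1,3,7,33), (0,1,1,34), (1,6,6,39), (1,4,8,39), (2,2,9,39), (0,4,9,39), (1,2,10,39),
     (7,10,16,35), (4,6,12,38), (3,4,5,40), (2,8,12,38), (1,4,7,40), (1,3,8,40), (1,1,1,41), (0,3,9,40),
     (9,10,12,37), (0,8,14,38), (8,9,14,37), (3,4,4,41), (2,3,6,41), (2,2,7,41), (0,4,7,41), (0,3,8,41),
     (8,9,13,38), (2,8,10,40), (7,7,17,45), (1,4,17,46), (3,4,14,47), (6,7,7,48), (0,0,12,48), (5,5,10,48),
     (3,7,10,48), (3,6,11,48), (2,7,11,48), (1,9,10,48), (9,9,11,47), (2,5,13,48)]),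
   (29, [(3,6,12,20), (2,7,12,20)]),
   (30, [(8,9,9,28), (2,4,10,30), (0,8,8,30), (1,2,3,32), (3,5,7,31), (2,2,12,30), (3,3,9,31), (1,5,9,31),
     (5,8,12,29), (6,6,13,29), (4,4,6,32), (0,2,3,33), (2,4,8,32), (2,10,13,29), (0,6,8,32), (2,2,10,32),
     (0,4,10,32), (3,5,5,33), (3,3,7,33), (0,1,3,34), (0,2,12,32), (1,3,9,33), (7,7,8,32), (5,8,9,32),
     (4,4,4,34), (2,4,6,34), (0,0,14,32), (0,1,2,35), (3,5,14,48), (9,9,13,47), (6,7,8,49), (2,5,15,48),
     (4,7,10,49), (4,6,11,49), (5,11,15,47), (3,6,12,49), (2,7,12,49), (0,0,3,51)]),
   (31, [])]"

definition quads_minus :: "(int \<times> (int \<times> int \<times> int \<times> int) list) list" where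
  "quads_minus = [
   (0, [(0,0,7,33), (5,9,12,30), (5,8,13,30), (5,5,5,33), (1,2,3,34), (6,8,11,31), (3,3,9,33), (1,5,9,33),
     (5,5,16,30), (3,10,12,31), (1,3,11,33), (6,7,11,32), (1,2,2,35), (0,1,4,35), (0,0,5,35), (1,1,13,33),
     (6,8,9,33), (5,8,10,33), (3,5,5,35), (2,5,8,41), (2,4,9,41), (8,8,8,40), (1,4,10,41), (0,5,10,41),
     (6,6,12,40), (4,8,12,40), (4,5,5,42), (3,4,7,42), (3,3,8,42), (1,5,8,42), (1,1,3,43), (0,5,9,42),
     (0,1,14,41), (4,4,16,40), (0,3,11,42), (4,11,20,37), (3,4,6,43), (2,4,7,43), (2,3,8,43), (3,6,14,49),
     (0,2,12,50), (4,4,15,49), (6,7,9,50), (5,7,10,50), (5,6,11,50), (3,9,10,50)]),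
   (1, []),
   (2, [(0,4,10,32), (3,5,5,33), (3,3,7,33), (1,1,2,34), (0,2,12,32), (1,3,9,33), (6,7,9,32), (5,7,10,32),
     (4,4,4,34), (2,4,6,34), (4,14,14,46), (1,9,12,48), (1,8,13,48), (0,11,11,48), (6,6,9,49), (5,6,10,49),
     (5,13,13,47), (3,3,16,48), (4,5,12,49)]),
   (3, []),
   (4, [(1,5,5,33), (1,3,7,33), (2,4,7,39), (2,3,8,39), (0,6,7,39), (0,1,13,38), (4,8,10,38), (0,3,10,39),
     (4,6,12,38), (0,2,11,39), (3,3,6,40), (2,3,7,40), (4,4,14,38), (2,6,14,38), (1,1,1,41), (8,11,12,37),
     (1,1,10,40), (7,10,14,37), (2,4,16,38), (2,4,5,41), (1,4,6,41), (0,5,6,41), (1,2,8,41), (0,1,2,49),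
     (2,6,13,47), (3,13,15,45), (2,5,14,47), (5,7,8,48), (0,0,12,48), (3,8,9,48), (4,5,11,48), (3,9,19,45),
     (3,5,12,48), (1,8,11,48)]),
   (5, []),
   (6, [(1,9,10,46), (0,5,16,45), (2,5,13,46), (1,6,13,46), (6,6,7,47), (4,7,8,47), (3,8,8,47), (3,6,10,47),
     (4,4,11,47), (2,6,11,47), (3,4,12,47), (8,8,12,46)]),
   (7, []),
   (8, [(10,10,11,33), (2,4,5,37), (1,4,6,37), (0,5,6,37), (1,2,8,37), (4,6,10,36), (0,2,9,37), (2,8,10,36),
     (0,1,10,37), (3,3,4,38), (1,4,5,38), (0,5,5,38), (0,3,7,38), (1,1,8,38), (8,8,13,35), (0,1,9,38),
     (6,9,14,35), (5,10,14,35), (2,3,4,39), (4,6,8,38), (0,3,6,39), (0,2,7,39), (2,6,10,38), (4,8,17,35),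
     (0,2,8,46), (3,4,12,45), (1,3,16,44), (0,8,11,45), (0,0,10,46), (5,6,7,46), (2,3,14,45), (3,6,9,46),
     (3,5,10,46), (2,2,15,45), (2,5,11,46), (1,6,11,46), (8,13,17,42), (0,3,16,45)]),
   (9, []),
   (10, [(3,4,11,44), (0,4,15,43), (3,3,12,44), (1,5,12,44), (0,3,16,43), (5,6,6,45), (4,5,8,45), (4,4,9,45),
     (2,6,9,45), (2,5,10,45), (1,6,10,45), (0,8,9,45), (6,8,12,44), (1,4,12,45), (0,5,12,45)]),
   (11, []),
   (12, [(0,1,9,34), (8,9,12,31), (2,3,4,35), (6,6,6,34), (0,3,6,35), (0,2,7,35), (4,4,10,34), (2,6,10,34),
     (7,8,13,32), (5,11,12,32), (2,3,3,36), (1,2,5,36), (1,1,6,36), (7,8,12,33), (0,2,18,32), (2,2,14,34),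
     (0,4,14,34), (4,7,17,32), (4,6,6,36), (1,2,4,37), (0,2,5,37), (0,1,6,37), (2,4,10,36), (0,8,8,36),
     (0,6,10,36), (0,2,6,44), (1,6,10,43), (0,8,9,43), (0,0,8,44), (1,4,12,43), (0,5,12,43), (4,5,7,44),
     (3,5,8,44), (3,4,9,44), (1,7,8,44), (7,9,9,43), (0,7,9,44), (1,4,11,44), (0,5,11,44), (1,3,12,44),
     (3,11,11,43), (4,4,7,45), (5,5,5,53), (3,5,7,53), (7,7,10,52)]),
   (13, []),
   (14, [(2,5,9,42), (3,3,10,42), (1,5,10,42), (2,3,11,42), (5,9,11,41), (3,5,19,39), (5,7,13,41),
     (4,4,7,43), (3,4,8,43), (8,13,14,39), (8,8,8,42), (2,3,10,43), (0,0,17,41), (2,2,11,43), (0,4,11,43),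
     (9,11,14,40), (4,5,5,44), (3,4,7,44)]),
   (15, []),
   (16, [(2,4,10,32), (0,8,8,32), (0,6,10,32), (8,8,9,31), (1,1,4,34), (0,1,5,34), (5,8,12,31), (6,6,13,31),
     (4,8,13,31), (7,8,9,32), (4,4,6,34), (2,6,6,34), (0,2,3,35), (1,12,12,31), (0,6,8,34), (2,2,10,34),
     (0,4,10,34), (6,6,11,33), (4,8,11,33), (2,2,2,42), (0,2,4,42), (2,3,10,41), (0,0,6,42), (2,2,11,41),
     (0,4,11,41), (0,1,15,40), (3,5,6,42), (2,5,7,42), (1,6,7,42), (2,3,9,42), (5,9,9,41), (1,3,10,42),
     (10,11,12,39), (1,2,11,42), (5,5,13,41), (4,4,5,43), (2,5,6,43), (1,6,6,43), (4,5,14,49), (1,10,12,49),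
     (1,5,18,48), (3,5,5,51), (3,3,7,51), (1,5,7,51), (4,7,11,50), (1,3,9,51)]),
   (17, []),
   (18, [(3,3,8,40), (1,5,8,40), (1,4,9,40), (0,5,9,40), (5,7,11,39), (6,13,15,36), (0,3,11,40), (4,4,5,41),
     (2,5,6,41), (1,6,6,41), (1,4,8,41), (2,2,9,41), (0,4,9,41), (1,2,10,41), (4,6,12,40), (2,10,10,40),
     (2,8,12,40), (3,3,6,42), (2,3,7,42), (5,7,9,41)]),
   (19, []),
   (20, [(4,5,12,31), (2,5,6,39), (1,6,6,39), (1,4,8,39), (0,2,2,40), (0,0,4,40), (1,2,10,39), (10,11,11,36),
     (1,7,15,37), (3,4,5,40), (7,11,14,36), (1,4,7,40), (1,3,8,40), (1,5,17,37), (0,3,9,40), (3,7,11,39),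
     (8,9,14,37), (6,12,13,37), (3,4,4,41), (2,3,6,41), (2,2,7,41), (0,4,7,41), (0,3,8,41), (2,7,12,47),
     (0,0,3,49), (1,4,17,46), (3,4,14,47), (6,7,7,48), (3,3,5,49), (1,5,5,49), (1,3,7,49), (3,6,11,48),
     (2,7,11,48), (1,1,9,49)]),
   (21, []),
   (22, [(3,3,6,38), (2,3,7,38), (0,1,12,37), (5,7,9,37), (1,2,9,38), (0,0,13,37), (1,1,10,38), (0,8,14,36),
     (3,4,4,39), (2,3,6,39), (2,2,7,39), (0,4,7,39), (0,3,8,39), (5,10,16,35), (2,8,10,38), (4,4,12,38),
     (2,6,12,38), (3,3,4,40), (1,4,5,40), (0,5,5,40), (0,3,7,40), (1,1,8,40)]),
   (23, []),
   (24, [(3,4,4,37), (2,3,6,37), (2,2,7,37), (0,4,7,37), (0,3,8,37), (0,0,2,38), (9,9,12,34), (3,3,15,35),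
     (1,5,15,35), (2,3,5,38), (1,3,6,38), (1,2,7,38), (3,7,9,37), (7,10,12,35), (3,5,11,37), (1,9,9,37),
     (1,7,11,37), (6,8,15,35), (2,2,5,39), (1,2,6,39), (6,11,11,36), (6,9,13,36), (0,1,8,39), (1,8,10,45),
     (2,5,12,45), (1,6,12,45), (0,0,1,47), (10,11,18,41), (5,5,8,46), (3,3,3,47), (1,3,5,47), (10,13,15,42),
     (1,1,7,47), (4,8,16,44), (3,3,12,46), (1,5,12,46), (2,10,16,44)]),
   (25, []),
   (26, [(2,8,10,34), (3,3,4,36), (1,4,5,36), (0,5,5,36), (0,3,7,36), (1,1,8,36), (2,4,14,34), (0,1,9,36),
     (1,9,9,35), (1,7,11,35), (2,2,5,37), (1,2,6,37), (1,5,13,35), (4,4,10,36), (0,1,8,37), (5,11,12,34),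
     (0,0,9,37), (2,4,12,36), (2,3,3,38), (1,2,5,38), (1,1,6,38), (6,8,13,35), (1,7,9,37), (3,3,11,37),
     (5,5,16,52)]),
   (27, []),
   (28, [(3,5,11,33), (1,9,9,33), (2,2,5,35), (1,2,6,35), (3,3,13,33), (1,5,13,33), (0,1,8,35), (0,0,0,36),
     (0,0,9,35), (7,7,14,32), (1,3,4,36), (0,3,5,36), (3,5,9,35), (0,1,7,36), (1,7,9,35), (3,3,11,35),
     (1,5,11,35), (8,9,9,34), (2,2,3,37), (0,3,4,37), (1,3,13,35), (5,8,13,34), (0,0,7,37), (3,11,12,34),
     (7,8,10,35), (3,4,10,43), (10,13,14,39), (2,4,11,43), (0,7,10,43), (2,3,12,43), (8,12,17,39),
     (5,5,6,44), (3,6,7,44), (2,7,7,44), (1,3,3,45), (1,1,5,45), (1,5,10,44), (2,3,11,44), (0,2,15,43),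
     (2,8,16,42), (10,11,14,41), (4,5,6,45), (2,9,14,51), (1,12,12,51), (7,8,9,52), (0,2,14,52)]),
   (29, []),
   (30, [(2,6,10,32), (0,0,9,33), (2,3,3,34), (1,2,5,34), (1,1,6,34), (3,5,9,33), (5,8,15,30), (1,7,9,33),
     (3,3,11,33), (1,5,11,33), (2,2,3,35), (0,3,4,35), (2,6,8,34), (1,3,13,33), (0,0,7,35), (0,8,8,34),
     (0,6,10,34), (5,5,5,35), (3,5,7,35), (1,1,4,36), (0,1,5,36), (1,5,9,35), (3,10,12,33), (7,8,9,34),
     (1,3,11,35), (1,6,18,49), (3,6,15,50), (7,8,8,51), (6,7,10,51), (6,6,11,51)]),
   (31, [])]"

section \<open>Nonnegative representations for \<open>a = 4\<close>\<close>

lemma nonneg_rep_of_fits: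
  assumes "fits 4 b n B" "B \<ge> 0" "B * B + b * B \<le> n" "3 * n < 4 * (B * B) + (8 + 3 * b) * B + 16"
  shows "\<exists>w\<ge>0. \<exists>x\<ge>0. \<exists>y\<ge>0. \<exists>z\<ge>0.
    n = w * (4 * w + b) + x * (4 * x + b) + y * (4 * y + b) + z * (4 * z + b)"
proof -
  have 4: "4 * B^2 \<le> 4 * (n - b * B)" using assms(3) by (simp add: power2_eq_square)
  have "3 * (n - b * B) < 4 * (B^2 + 2 * B + 4)"
    using assms(4) by (simp add: power2_eq_square algebra_simps)
  then show ?thesis using fits_imp_rep[OF assms(1) _ 4] assms(2) by (metis zero_less_numeral)
qed

text \<open>Let \<open>k\<close> be least with \<open>3 * n < f k\<close>. All 16 values
  \<open>B = k, ..., k + 15\<close> satisfy both size conditions, and one of them fits.\<close>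

lemma nonneg_rep_of_large:
  assumes gap: "\<forall>r\<in>set [0..31]. \<forall>t\<in>set [0..31]. \<exists>i\<in>set [0..15]. fits 4 b r (t + i)"
    and b: "b = 1 \<or> b = - 1" and n: "14592 \<le> n"
  shows "\<exists>w\<ge>0. \<exists>x\<ge>0. \<exists>y\<ge>0. \<exists>z\<ge>0.
    n = w * (4 * w + b) + x * (4 * x + b) + y * (4 * y + b) + z * (4 * z + b)"
proof -
  define f where "f t = 4 * (t * t) + (8 + 3 * b) * t + 16" for t :: int
  have f_mono: "f s \<le> f t" if "0 \<le> s" "s \<le> t" for s t
    unfolding f_def using that b by (intro add_mono mult_left_mono mult_mono) auto
  define k where "k = (LEAST k. 3 * n < f (int k))"
  have "5 * n \<le> (8 + 3 * b) * n" using n b by auto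
  moreover have "0 \<le> n * n" by simp
  ultimately have "3 * n < f n" unfolding f_def using n by linarith
  then have "3 * n < f (int (nat n))" using n by simp
  then have k: "3 * n < f (int k)" unfolding k_def by (rule LeastI)
  \<comment> \<open>For \<open>b = 1\<close> the value \<open>f 103\<close> is 43585, below
    \<open>3 * 14592 = 43776\<close>.\<close>
  have "f 103 \<le> 3 * n" using b n by (auto simp: f_def)
  then have k104: "104 \<le> int k" using k f_mono[of "int k" 103] by linarith
  have "\<not> 3 * n < f (int (k - 1))" by (rule not_less_Least) (use k104 in \<open>simp add: k_def\<close>)
  moreover have "int (k - 1) = int k - 1" using k104 by simp
  ultimately have k1: "f (int k - 1) \<le> 3 * n" by simp
  have "int k mod 32 \<in> set [0..31]" "n mod 32 \<in> set [0..31]" unfolding set_upto by simp_all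
  with gap obtain i where i': "i \<in> set [0..15]" "fits 4 b (n mod 32) (int k mod 32 + i)" by blast
  then have i: "0 \<le> i" "i \<le> 15" unfolding set_upto by simp_all
  have "fits 4 b (n mod 32 + 8 * 4 * (n div 32)) (int k mod 32 + i + 32 * (int k div 32))"
    by (subst fits_shift[of 4 b _ "b * (int k div 32)"]) (use i'(2) in auto)
  then have fits: "fits 4 b n (int k + i)" by (simp add: algebra_simps)
  have "3 * n < f (int k + i)" using k f_mono[of "int k" "int k + i"] i by linarith
  moreover have "(int k + i) * (int k + i) + b * (int k + i) \<le> n"
  proof -
    \<comment> \<open>With \<open>t = k\<close> and \<open>s = k * k\<close> the claim follows from
      \<open>3 * k^2 + 93 * k + 720 \<le> 4 * k^2 - 3 * k + 15\<close>, valid for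
      \<open>k \<ge> 104\<close>; the right side is at most
      \<open>f (k - 1) \<le> 3 * n\<close>.\<close>
    have aux: "3 * X \<le> 3 * n" if "X \<le> Y" "Y = s + 31 * t + 240" "104 * t \<le> s" "u = s - 2 * t + 1"
      "5 * (t - 1) \<le> v" "4 * u + v + 16 \<le> 3 * n" "104 \<le> t" for X Y s t u v :: int
      using that by (smt (verit))
    have "(int k + i) * (int k + i) + b * (int k + i) \<le> (int k + 15) * (int k + 15) + 1 * (int k + 15)"
      using i b k104 by (intro add_mono mult_mono) auto
    moreover have "(int k + 15) * (int k + 15) + 1 * (int k + 15) = int k * int k + 31 * int k + 240"
      by (simp add: algebra_simps)
    moreover have "104 * int k \<le> int k * int k" using k104 by (simp add: mult_right_mono)
    moreover have "(int k - 1) * (int k - 1) = int k * int k - 2 * int k + 1" by (simp add: algebra_simps)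
    moreover have "5 * (int k - 1) \<le> (8 + 3 * b) * (int k - 1)" using b k104 by auto
    moreover note k1[unfolded f_def] k104
    ultimately have "3 * ((int k + i) * (int k + i) + b * (int k + i)) \<le> 3 * n" by (rule aux)
    then show ?thesis by simp
  qed
  ultimately show ?thesis using nonneg_rep_of_fits[OF fits] i unfolding f_def by simp
qed

lemma nonneg_rep_of_check:
  assumes check: "list_all (cover_check n0 b) qss" "map fst qss = [0..31]"
    and n: "n0 \<le> n" "2048 \<le> n" "n < 14848"
  shows "\<exists>w\<ge>0. \<exists>x\<ge>0. \<exists>y\<ge>0. \<exists>z\<ge>0.
    n = w * (4 * w + b) + x * (4 * x + b) + y * (4 * y + b) + z * (4 * z + b)"
proof -
  define r where "r = n mod 32"
  have "r \<in> set (map fst qss)" unfolding check(2) set_upto by (simp add: r_def)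
  then obtain qs where qs: "(r, qs) \<in> set qss" by auto
  then have cc: "cover_check n0 b (r, qs)" using check(1) by (simp add: list_all_iff)
  define i j where "i = n div 32 mod 16" and "j = n div 512"
  have nij: "n = 512 * j + 32 * i + r"
  proof -
    have "j = n div 32 div 16" by (simp add: j_def zdiv_zmult2_eq[symmetric])
    then have "n div 32 = 16 * j + i" unfolding i_def by simp
    moreover have "n = 32 * (n div 32) + r" by (simp add: r_def)
    ultimately show ?thesis by simp
  qed
  have "4 \<le> j" "j \<le> 28" using n unfolding j_def by presburger+
  then have "i \<in> set [0..15]" "j \<in> set [4..28]" unfolding i_def set_upto by simp_all
  then have "covered n0 (windows b r) (map (quad_value b) qs) (512 * j + 32 * i + r)"
    using cc unfolding cover_check_def all_covered_def list_all_iff prod.case by blast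
  then have "covered n0 (windows b r) (map (quad_value b) qs) n" unfolding nij .
  then consider l h where "(l, h) \<in> set (windows b r)" "l \<le> n" "3 * n < h" | q where "q \<in> set qs" "n = quad_value b q"
    using n(1) by (auto simp: covered_def list_ex_iff)
  then show ?thesis
  proof cases
    case 1
    have "(l, h) \<in> (\<lambda>B. (B * B + b * B, 4 * (B * B) + (8 + 3 * b) * B + 16)) ` {B \<in> {38..122}. fits 4 b r B}"
      using 1(1) unfolding windows_def set_map set_filter set_upto .
    then obtain B where B: "fits 4 b r B" "38 \<le> B" "B * B + b * B \<le> n" "3 * n < 4 * (B * B) + (8 + 3 * b) * B + 16"
      using 1(2,3) by auto
    have "fits 4 b (r + 8 * 4 * (n div 32)) (B + 32 * 0)"
      by (subst fits_shift[of 4 b 0 0]) (use B(1) in auto)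
    then have "fits 4 b n B" by (simp add: r_def)
    then show ?thesis using B by (intro nonneg_rep_of_fits) auto
  next
    case 2
    obtain w x y z where q: "q = (w, x, y, z)" by (cases q) auto
    have "0 \<le> w" "0 \<le> x" "0 \<le> y" "0 \<le> z" using cc 2(1) by (auto simp: cover_check_def list_all_iff q)
    then show ?thesis using 2(2) by (auto simp: quad_value_def q)
  qed
qed

section \<open>Computations and conclusion\<close>

lemma residues_4_1: "\<forall>r\<in>set [0..8 * 4 - 1]. \<exists>B\<in>set [-8..8]. fits 4 1 r B" by code_simp

lemma residues_6_1: "\<forall>r\<in>set [0..8 * 6 - 1]. \<exists>B\<in>set [-12..12]. fits 6 1 r B" by code_simp

lemma residues_6_5: "\<forall>r\<in>set [0..8 * 6 - 1]. \<exists>B\<in>set [-12..12]. fits 6 5 r B" by code_simp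

text \<open>The three searches end at 71, 227 and 275 because the bound of
  \<open>mem_T_of_large\<close> holds from 72, 228 and 276 on. The values 4, 6 and 7 of
  \<open>K\<close> are the least that \<open>set_pairs\<close> admits there. For
  \<open>a = 6\<close> only the largest gap matters, so the search starts at it.\<close>

lemma misses_4_1: "misses (pairs 4 1 4 71) [0..71] = [1, 2, 4, 7, 30]" by code_simp

lemma misses_6_1: "misses (pairs 6 1 6 227) [168..227] = [168]" by code_simp

lemma misses_6_5: "misses (pairs 6 5 7 275) [182..275] = [182]" by code_simp

text \<open>By \<open>fits_shift\<close> the residues modulo 32 of \<open>n\<close> and of the
  starting point decide, so among any 16 consecutive \<open>B\<close> at least one fits.\<close>

lemma residue_gap_plus:
  "\<forall>r\<in>set [0..31]. \<forall>t\<in>set [0..31]. \<exists>i\<in>set [0..15]. fits 4 1 r (t + i)" by code_simp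

lemma residue_gap_minus:
  "\<forall>r\<in>set [0..31]. \<forall>t\<in>set [0..31]. \<exists>i\<in>set [0..15]. fits 4 (- 1) r (t + i)" by code_simp

lemma quads_plus_index: "map fst quads_plus = [0..31]" by code_simp

lemma quads_minus_index: "map fst quads_minus = [0..31]" by code_simp

lemma quads_plus_check: "list_all (cover_check 2283 1) quads_plus" by code_simp

lemma quads_minus_check: "list_all (cover_check 4501 (- 1)) quads_minus" by code_simp

lemma nonneg_rep_plus:
  assumes "2283 \<le> n"
  shows "\<exists>w\<ge>0. \<exists>x\<ge>0. \<exists>y\<ge>0. \<exists>z\<ge>0.
    n = w * (4 * w + 1) + x * (4 * x + 1) + y * (4 * y + 1) + z * (4 * z + (1::int))"
  using nonneg_rep_of_check[OF quads_plus_check quads_plus_index, of n]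
    nonneg_rep_of_large[OF residue_gap_plus, of n] assms by (cases "n < 14848") auto

lemma nonneg_rep_minus:
  assumes "4501 \<le> n"
  shows "\<exists>w\<ge>0. \<exists>x\<ge>0. \<exists>y\<ge>0. \<exists>z\<ge>0.
    n = w * (4 * w - 1) + x * (4 * x - 1) + y * (4 * y - 1) + z * (4 * z - (1::int))"
  using nonneg_rep_of_check[OF quads_minus_check quads_minus_index, of n]
    nonneg_rep_of_large[OF residue_gap_minus, of n] assms by (cases "n < 14848") auto

theorem corollary4:
  shows "T 4 1 = \<nat> - {1, 2, 4, 7, 30} \<and>
    (finite (\<nat> - T 6 1) \<and> \<nat> - T 6 1 \<noteq> {} \<and> Max (\<nat> - T 6 1) = 168) \<and>
    (finite (\<nat> - T 6 5) \<and> \<nat> - T 6 5 \<noteq> {} \<and> Max (\<nat> - T 6 5) = 182) \<and>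
    (\<forall>n::int. n \<ge> 2283 \<longrightarrow> (\<exists>w\<in>\<nat>. \<exists>x\<in>\<nat>. \<exists>y\<in>\<nat>. \<exists>z\<in>\<nat>.
       n = w * (4 * w + 1) + x * (4 * x + 1) + y * (4 * y + 1) + z * (4 * z + 1))) \<and>
    (\<forall>n::int. n > 4500 \<longrightarrow> (\<exists>w\<in>\<nat>. \<exists>x\<in>\<nat>. \<exists>y\<in>\<nat>. \<exists>z\<in>\<nat>.
       n = w * (4 * w - 1) + x * (4 * x - 1) + y * (4 * y - 1) + z * (4 * z - 1)))"
proof (intro conjI)
  have "n \<in> T 4 1 \<longleftrightarrow> n \<notin> {1, 2, 4, 7, 30}" if "n \<ge> 0" for n
  proof (cases "n \<le> 71")
    case True
    then show ?thesis using mem_T_iff_not_miss[of 1 4 4 71 0 n] that unfolding misses_4_1 by simp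
  next
    case False
    then show ?thesis using mem_T_of_large[of 4 8 1 n] residues_4_1 by simp
  qed
  then show "T 4 1 = \<nat> - {1, 2, 4, 7, 30}"
    using T_subset_Nats[of 1 4] by (auto simp: int_mem_Nats_iff)
next
  have "n \<in> T 6 1 \<longleftrightarrow> n \<noteq> 168" if "n \<ge> 168" for n
  proof (cases "n \<le> 227")
    case True
    then show ?thesis using mem_T_iff_not_miss[of 1 6 6 227 168 n] that unfolding misses_6_1 by simp
  next
    case False
    then show ?thesis using mem_T_of_large[of 6 12 1 n] residues_6_1 by simp
  qed
  then have "finite (\<nat> - T 6 1) \<and> \<nat> - T 6 1 \<noteq> {} \<and> Max (\<nat> - T 6 1) = 168"
    by (intro Max_gaps) auto
  then show "finite (\<nat> - T 6 1)" "\<nat> - T 6 1 \<noteq> {}" "Max (\<nat> - T 6 1) = 168" by blast+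
next
  have "n \<in> T 6 5 \<longleftrightarrow> n \<noteq> 182" if "n \<ge> 182" for n
  proof (cases "n \<le> 275")
    case True
    then show ?thesis using mem_T_iff_not_miss[of 5 6 7 275 182 n] that unfolding misses_6_5 by simp
  next
    case False
    then show ?thesis using mem_T_of_large[of 6 12 5 n] residues_6_5 by simp
  qed
  then have "finite (\<nat> - T 6 5) \<and> \<nat> - T 6 5 \<noteq> {} \<and> Max (\<nat> - T 6 5) = 182"
    by (intro Max_gaps) auto
  then show "finite (\<nat> - T 6 5)" "\<nat> - T 6 5 \<noteq> {}" "Max (\<nat> - T 6 5) = 182" by blast+
next
  show "\<forall>n::int. n \<ge> 2283 \<longrightarrow> (\<exists>w\<in>\<nat>. \<exists>x\<in>\<nat>. \<exists>y\<in>\<nat>. \<exists>z\<in>\<nat>.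
       n = w * (4 * w + 1) + x * (4 * x + 1) + y * (4 * y + 1) + z * (4 * z + 1))"
    using nonneg_rep_plus by (simp only: Bex_def int_mem_Nats_iff) blast
next
  show "\<forall>n::int. n > 4500 \<longrightarrow> (\<exists>w\<in>\<nat>. \<exists>x\<in>\<nat>. \<exists>y\<in>\<nat>. \<exists>z\<in>\<nat>.
       n = w * (4 * w - 1) + x * (4 * x - 1) + y * (4 * y - 1) + z * (4 * z - 1))"
  proof (intro allI impI)
    fix n :: int assume "n > 4500"
    then have "4501 \<le> n" by simp
    from nonneg_rep_minus[OF this] show "\<exists>w\<in>\<nat>. \<exists>x\<in>\<nat>. \<exists>y\<in>\<nat>. \<exists>z\<in>\<nat>.
       n = w * (4 * w - 1) + x * (4 * x - 1) + y * (4 * y - 1) + z * (4 * z - 1)"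
      by (simp only: Bex_def int_mem_Nats_iff)
  qed
qed

end
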